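(* Suppose $T\in B(\mathcal H)$ is a hyponormal operator and the boundary $\partial(\sigma(T))$ of the spectrum of $T$ excludes at least one point of the unit circle. If $\mathcal S(T,T^* )$ is an SI semigroup, then $T$ is normal.
   Context: $\mathcal H$ is a complex Hilbert space. $T$ is hyponormal if $T^*T-TT^*\ge0$. The boundary of $\sigma(T)$ is taken in $\mathbb C$. $\mathcal S(T,T^* )$ is the multiplicative semigroup of all finite nonempty products of $T$ and $T^*$. An ideal of a semigroup $\mathcal S$ is a nonempty subset $J\subset\mathcal S$ with $XA,AX\in J$ for $A\in J$, $X\in\mathcal S$. $\mathcal S$ is an SI (selfadjoint-ideal) semigroup if every ideal $J$ of $\mathcal S$ satisfies $J^*=\{A^*:A\in J\}\subset J$. *)

theory Defs
  imports "HOL-Analysis.Analysis"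
begin

text \<open>The library's inner product spaces are real only. A complex Hilbert space is a Banach space
  whose real scalar multiplication extends to a complex one and whose norm is induced by
  \<^term>\<open>cinner\<close>, which is linear in the first argument.\<close>

class complex_hilbert_space = banach +
  fixes scaleC :: "complex \<Rightarrow> 'a \<Rightarrow> 'a"  (infixr "*\<^sub>C" 75)
    and cinner :: "'a \<Rightarrow> 'a \<Rightarrow> complex"
  assumes scaleC_add_right: "a *\<^sub>C (x + y) = a *\<^sub>C x + a *\<^sub>C y"
    and scaleC_add_left: "(a + b) *\<^sub>C x = a *\<^sub>C x + b *\<^sub>C x"
    and scaleC_scaleC: "a *\<^sub>C b *\<^sub>C x = (a * b) *\<^sub>C x"
    and scaleC_one: "1 *\<^sub>C x = x"
    and scaleR_scaleC: "r *\<^sub>R x = complex_of_real r *\<^sub>C x"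
    and cinner_commute: "cinner x y = cnj (cinner y x)"
    and cinner_add_left: "cinner (x + y) z = cinner x z + cinner y z"
    and cinner_scaleC_left: "cinner (a *\<^sub>C x) y = a * cinner x y"
    and cinner_self: "cinner x x = complex_of_real ((norm x)\<^sup>2)"

instantiation complex :: complex_hilbert_space
begin

definition "scaleC a x = a * (x::complex)"
definition "cinner x y = x * cnj (y::complex)"

instance
proof
  fix a b x y z :: complex and r :: real
  show "a *\<^sub>C (x + y) = a *\<^sub>C x + a *\<^sub>C y"
    by (simp add: scaleC_complex_def distrib_left)
  show "(a + b) *\<^sub>C x = a *\<^sub>C x + b *\<^sub>C x"
    by (simp add: scaleC_complex_def distrib_right)
  show "a *\<^sub>C b *\<^sub>C x = (a * b) *\<^sub>C x"
    by (simp add: scaleC_complex_def)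
  show "1 *\<^sub>C x = x"
    by (simp add: scaleC_complex_def)
  show "r *\<^sub>R x = complex_of_real r *\<^sub>C x"
    by (simp add: scaleC_complex_def scaleR_conv_of_real)
  show "cinner x y = cnj (cinner y x)"
    by (simp add: cinner_complex_def)
  show "cinner (x + y) z = cinner x z + cinner y z"
    by (simp add: cinner_complex_def distrib_right)
  show "cinner (a *\<^sub>C x) y = a * cinner x y"
    by (simp add: cinner_complex_def scaleC_complex_def)
  show "cinner x x = complex_of_real ((norm x)\<^sup>2)"
    using complex_norm_square[of x] by (simp add: cinner_complex_def)
qed

end

text \<open>Elements of $B(\mathcal H)$ are functions satisfying the following predicate; their product is
  composition. The notions below are meant for such functions only and do not repeat the requirement.\<close>

definition bounded_clinear :: "('a::complex_hilbert_space \<Rightarrow> 'a) \<Rightarrow> bool" where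
  "bounded_clinear T \<longleftrightarrow> bounded_linear T \<and> (\<forall>c x. T (c *\<^sub>C x) = c *\<^sub>C T x)"

text \<open>The adjoint exists for every bounded operator by the Riesz representation theorem; uniqueness is
  \<open>cadjoint_eqI\<close> below.\<close>

definition cadjoint :: "('a::complex_hilbert_space \<Rightarrow> 'a) \<Rightarrow> 'a \<Rightarrow> 'a" where
  "cadjoint T = (THE S. bounded_clinear S \<and> (\<forall>x y. cinner (T x) y = cinner x (S y)))"

lemma cinner_diff_left: "cinner (x - y) z = cinner x z - cinner y z"
  for x :: "'a::complex_hilbert_space"
  using cinner_add_left[of "x - y" y z] by simp

lemma cadjoint_eqI:
  assumes S: "bounded_clinear S" "\<And>x y. cinner (T x) y = cinner x (S y)"
  shows "cadjoint T = S"
  unfolding cadjoint_def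
proof (rule the_equality)
  show "bounded_clinear S \<and> (\<forall>x y. cinner (T x) y = cinner x (S y))"
    using S by blast
next
  fix R assume R: "bounded_clinear R \<and> (\<forall>x y. cinner (T x) y = cinner x (R y))"
  show "R = S"
  proof
    fix y
    have "cinner x (R y) = cinner x (S y)" for x
      using R S(2) by metis
    then have "cinner (R y) x = cinner (S y) x" for x
      by (metis cinner_commute)
    then have "cinner (R y - S y) (R y - S y) = 0"
      by (simp add: cinner_diff_left)
    then show "R y = S y"
      by (simp add: cinner_self)
  qed
qed

definition positive_operator :: "('a::complex_hilbert_space \<Rightarrow> 'a) \<Rightarrow> bool" where
  "positive_operator A \<longleftrightarrow> (\<forall>x. cinner (A x) x \<in> \<real>\<^sub>\<ge>\<^sub>0)"

definition hyponormal :: "('a::complex_hilbert_space \<Rightarrow> 'a) \<Rightarrow> bool" where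
  "hyponormal T \<longleftrightarrow> positive_operator (\<lambda>x. (cadjoint T \<circ> T) x - (T \<circ> cadjoint T) x)"

definition normal_operator :: "('a::complex_hilbert_space \<Rightarrow> 'a) \<Rightarrow> bool" where
  "normal_operator T \<longleftrightarrow> cadjoint T \<circ> T = T \<circ> cadjoint T"

definition invertible_operator :: "('a::complex_hilbert_space \<Rightarrow> 'a) \<Rightarrow> bool" where
  "invertible_operator A \<longleftrightarrow> (\<exists>B. bounded_clinear B \<and> A \<circ> B = id \<and> B \<circ> A = id)"

definition spectrum :: "('a::complex_hilbert_space \<Rightarrow> 'a) \<Rightarrow> complex set" where
  "spectrum T = {z. \<not> invertible_operator (\<lambda>x. T x - z *\<^sub>C x)}"

definition star_semigroup :: "('a::complex_hilbert_space \<Rightarrow> 'a) \<Rightarrow> ('a \<Rightarrow> 'a) set" where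
  "star_semigroup T = {foldr (\<circ>) As id |As. As \<noteq> [] \<and> set As \<subseteq> {T, cadjoint T}}"

lemma star_semigroup_closed:
  assumes "A \<in> star_semigroup T" "B \<in> star_semigroup T"
  shows "A \<circ> B \<in> star_semigroup T"
proof -
  obtain As Bs where AB: "A = foldr (\<circ>) As id" "B = foldr (\<circ>) Bs id"
    "As \<noteq> []" "set As \<subseteq> {T, cadjoint T}" "set Bs \<subseteq> {T, cadjoint T}"
    using assms unfolding star_semigroup_def by blast
  have "foldr (\<circ>) Cs id \<circ> B = foldr (\<circ>) (Cs @ Bs) id" for Cs
  proof (induction Cs)
    case Nil
    have "foldr (\<circ>) [] id = (id :: 'a \<Rightarrow> 'a)"
      by simp
    then show ?case
      by (simp only: AB(2) append_Nil id_comp)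
  next
    case (Cons C Cs)
    have "foldr (\<circ>) (C # Ds) id = C \<circ> foldr (\<circ>) Ds id" for Ds :: "('a \<Rightarrow> 'a) list"
      by simp
    then show ?case
      by (simp only: append_Cons comp_assoc Cons.IH)
  qed
  moreover have "As @ Bs \<noteq> []" "set (As @ Bs) \<subseteq> {T, cadjoint T}"
    using AB by auto
  ultimately show ?thesis
    unfolding star_semigroup_def AB(1) by blast
qed

definition semigroup_ideal ::
    "('a::complex_hilbert_space \<Rightarrow> 'a) set \<Rightarrow> ('a \<Rightarrow> 'a) set \<Rightarrow> bool" where
  "semigroup_ideal J S \<longleftrightarrow> J \<noteq> {} \<and> J \<subseteq> S \<and> (\<forall>A\<in>J. \<forall>X\<in>S. X \<circ> A \<in> J \<and> A \<circ> X \<in> J)"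

definition SI_semigroup :: "('a::complex_hilbert_space \<Rightarrow> 'a) set \<Rightarrow> bool" where
  "SI_semigroup S \<longleftrightarrow> (\<forall>J. semigroup_ideal J S \<longrightarrow> cadjoint ` J \<subseteq> J)"

end

theory Submission
  imports Defs "HOL-Complex_Analysis.Complex_Analysis"
begin

text \<open>If $T \neq T^*$, the ideal of all words containing $T$ gives $T^* = W(T, T^*)$ for a word $W$ of
  length $n \geq 2$. Comparing norms on vectors that almost attain $\|T\|$ yields $\|T\| \leq 1$. For
  hyponormal $T$ an approximate eigenvector for $z$ is one of $T^*$ for $\bar z$, and comparing
  $\bar z$ with $W(z, \bar z)$ bounds $T - z$ below by a multiple of $|z| (1 - |z|)$. So the
  boundary of the spectrum lies in the unit circle and $0$; as it misses a point of the circle, the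
  punctured open unit disc lies in the resolvent set, where the resolvent is of order $1/|z|$ near
  $0$. Hence $0$ is at most a simple pole and $\mathcal H$ is the orthogonal sum of $\ker T$ and a
  reducing subspace on which $T$ is invertible. The inverse $S$ there, extended by $0$, is again
  hyponormal with $S^*$ equal to a word of length $n$ in $S$ and $S^*$, so $\|S\| \leq 1$ as well,
  which makes $T$ unitary on the subspace.\<close>

subsection \<open>Complex inner products and adjoints\<close>

text \<open>Almost norming vectors survive T only because of hyponormality. If x is a unit vector
  with \<open>norm (T x)\<close> close to r = \<parallel>T\<parallel>, then the adjoint maps T x
  close to r^2 x, and T x is almost norming again because \<open>norm (T (T x))\<close> dominates
  \<open>norm (cadjoint T (T x))\<close>. The adjoint is thus under control only on vectors of the
  form T y, so words are tested on high powers of T applied to almost norming vectors. The spectral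
  hypothesis cannot be recovered from the word equation: the unilateral shift is hyponormal and
  generates a bicyclic semigroup, whose only ideal is itself, but it is not normal. Its spectrum is
  the closed disc, and this is the alternative that the missing point of the circle rules out. The
  lower bound for T - z degenerates at z = 0, so invertibility off the kernel has to come from the
  growth of the resolvent near 0. The inverse is built as a group inverse on the whole space, so
  that the norm argument for T applies to it unchanged.\<close>

lemma cinner_add_right: "cinner x (y + z) = cinner x y + cinner x z"
  for x :: "'a::complex_hilbert_space"
  unfolding cinner_commute[of x] cinner_add_left by simp

lemma cinner_diff_right: "cinner x (y - z) = cinner x y - cinner x z"
  for x :: "'a::complex_hilbert_space"
  unfolding cinner_commute[of x] cinner_diff_left by simp

lemma cinner_scaleC_right: "cinner x (c *\<^sub>C y) = cnj c * cinner x y"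
  for x :: "'a::complex_hilbert_space"
  unfolding cinner_commute[of x] cinner_scaleC_left by simp

lemma cinner_zero_left [simp]: "cinner 0 y = 0" for y :: "'a::complex_hilbert_space"
  using cinner_diff_left[of 0 0 y] by simp

lemma cinner_zero_right [simp]: "cinner y 0 = 0" for y :: "'a::complex_hilbert_space"
  using cinner_diff_right[of y 0 0] by simp

lemma scaleC_zero_right [simp]: "c *\<^sub>C 0 = (0::'a::complex_hilbert_space)"
  using scaleC_add_right[of c 0 "0::'a"] by simp

lemma scaleC_zero_left [simp]: "0 *\<^sub>C x = (0::'a::complex_hilbert_space)"
  using scaleC_add_left[of 0 0 x] by simp

lemma scaleC_diff_right: "c *\<^sub>C (x - y) = c *\<^sub>C x - c *\<^sub>C y" for x :: "'a::complex_hilbert_space"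
  using scaleC_add_right[of c "x - y" y] unfolding eq_diff_eq by simp

lemma scaleC_diff_left: "(a - b) *\<^sub>C x = a *\<^sub>C x - b *\<^sub>C x" for x :: "'a::complex_hilbert_space"
  using scaleC_add_left[of "a - b" b x] unfolding eq_diff_eq by simp

lemma scaleC_minus_left: "(- a) *\<^sub>C x = - (a *\<^sub>C x)" for x :: "'a::complex_hilbert_space"
  using scaleC_diff_left[of 0 a x] by simp

lemma norm_eq_Re_cinner: "(norm x)\<^sup>2 = Re (cinner x x)" for x :: "'a::complex_hilbert_space"
  by (simp add: cinner_self)

lemma norm_scaleC: "norm (c *\<^sub>C x) = cmod c * norm x" for x :: "'a::complex_hilbert_space"
proof -
  have "complex_of_real ((norm (c *\<^sub>C x))\<^sup>2) = c * cnj c * cinner x x"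
    unfolding cinner_self[symmetric] cinner_scaleC_left cinner_scaleC_right by simp
  also have "\<dots> = complex_of_real ((cmod c * norm x)\<^sup>2)"
    unfolding cinner_self complex_norm_square[symmetric]
    by (simp only: power_mult_distrib of_real_mult of_real_power)
  finally have "(norm (c *\<^sub>C x))\<^sup>2 = (cmod c * norm x)\<^sup>2"
    unfolding of_real_eq_iff .
  then show ?thesis
    by simp
qed

lemma Re_cinner_commute: "Re (cinner y x) = Re (cinner x y)" for x :: "'a::complex_hilbert_space"
  using arg_cong[OF cinner_commute[of y x], of Re] by simp

lemma norm_diff_square:
  "(norm (x - y))\<^sup>2 = (norm x)\<^sup>2 + (norm y)\<^sup>2 - 2 * Re (cinner x y)"
  for x :: "'a::complex_hilbert_space"
  using Re_cinner_commute[of y x] by (simp add: norm_eq_Re_cinner cinner_diff_left cinner_diff_right)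

lemma norm_add_square:
  "(norm (x + y))\<^sup>2 = (norm x)\<^sup>2 + (norm y)\<^sup>2 + 2 * Re (cinner x y)"
  for x :: "'a::complex_hilbert_space"
  using Re_cinner_commute[of y x] by (simp add: norm_eq_Re_cinner cinner_add_left cinner_add_right)

lemma cinner_bound: "cmod (cinner x y) \<le> norm x * norm y"
  for x :: "'a::complex_hilbert_space"
proof (cases "y = 0")
  case False
  \<comment> \<open>c y is the orthogonal projection of x onto the line through y; the squared
    distance of x from it is nonnegative.\<close>
  define c where "c = cinner x y / complex_of_real ((norm y)\<^sup>2)"
  have ny: "(norm y)\<^sup>2 > 0"
    using False by simp
  have "cinner x (c *\<^sub>C y) = complex_of_real ((cmod (cinner x y))\<^sup>2 / (norm y)\<^sup>2)"
    using complex_norm_square[of "cinner x y"]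
    by (simp add: c_def cinner_scaleC_right mult.commute)
  then have 1: "Re (cinner x (c *\<^sub>C y)) = (cmod (cinner x y))\<^sup>2 / (norm y)\<^sup>2"
    by simp
  have 2: "(norm (c *\<^sub>C y))\<^sup>2 = (cmod (cinner x y))\<^sup>2 / (norm y)\<^sup>2"
  proof -
    have "cmod c = cmod (cinner x y) / (norm y)\<^sup>2"
      unfolding c_def norm_divide norm_of_real by simp
    then show ?thesis
      using False by (simp add: norm_scaleC power2_eq_square)
  qed
  have "0 \<le> (norm (x - c *\<^sub>C y))\<^sup>2"
    by simp
  also have "\<dots> = (norm x)\<^sup>2 - (cmod (cinner x y))\<^sup>2 / (norm y)\<^sup>2"
    unfolding norm_diff_square 1 2 by simp
  finally have "(cmod (cinner x y))\<^sup>2 \<le> (norm x * norm y)\<^sup>2"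
    using ny by (simp add: field_simps power_mult_distrib)
  then show ?thesis
    by (rule power2_le_imp_le) simp
qed simp

lemma tendsto_cinner_left:
  fixes y :: "'a::complex_hilbert_space"
  assumes "(f \<longlongrightarrow> x) F"
  shows "((\<lambda>t. cinner (f t) y) \<longlongrightarrow> cinner x y) F"
proof (rule LIM_zero_cancel)
  have "((\<lambda>t. norm (f t - x) * norm y) \<longlongrightarrow> norm (x - x) * norm y) F"
    using assms by (intro tendsto_intros)
  then have lim: "((\<lambda>t. norm (f t - x) * norm y) \<longlongrightarrow> 0) F"
    by simp
  show "((\<lambda>t. cinner (f t) y - cinner x y) \<longlongrightarrow> 0) F"
  proof (rule Lim_null_comparison[OF _ lim], rule always_eventually, rule allI)
    show "norm (cinner (f t) y - cinner x y) \<le> norm (f t - x) * norm y" for t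
      using cinner_bound[of "f t - x" y] unfolding cinner_diff_left .
  qed
qed

lemma cinner_eqI:
  fixes y z :: "'a::complex_hilbert_space"
  assumes "\<And>x. cinner x y = cinner x z"
  shows "y = z"
proof -
  have "cinner (y - z) (y - z) = 0"
    using assms[of "y - z"] by (simp add: cinner_diff_right)
  then show ?thesis
    by (simp add: cinner_self)
qed

section \<open>The Riesz representation theorem and adjoints\<close>

text \<open>The representing vector minimises \<open>\<parallel>x\<parallel>\<^sup>2 - 2 Re (f x)\<close>.\<close>

lemma riesz_representation:
  fixes f :: "'a::complex_hilbert_space \<Rightarrow> complex"
  assumes add: "\<And>x y. f (x + y) = f x + f y"
    and scale: "\<And>c x. f (c *\<^sub>C x) = c * f x"
    and bound: "\<And>x. cmod (f x) \<le> B * norm x"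
  shows "\<exists>y. \<forall>x. f x = cinner x y"
proof -
  define q where "q x = (norm x)\<^sup>2 - 2 * Re (f x)" for x
  have fR: "f (r *\<^sub>R x) = complex_of_real r * f x" for r x
    by (simp add: scaleR_scaleC scale)
  have fdiff: "f (x - y) = f x - f y" for x y
    using add[of "x - y" y] by simp
  \<comment> \<open>Parallelogram law: the linear terms cancel against those of the midpoint, so two
    nearly minimal points are close to each other.\<close>
  have cauchy: "(norm (x - y))\<^sup>2 = 2 * (q x + q y - 2 * q ((1/2) *\<^sub>R (x + y)))" for x y
  proof -
    have "(norm ((1/2) *\<^sub>R (x + y)))\<^sup>2 = (norm (x + y))\<^sup>2 / 4"
      by (simp add: power_mult_distrib power_divide)
    then show ?thesis
      unfolding q_def fR add by (simp add: norm_add_square norm_diff_square field_simps)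
  qed
  have lower: "q x \<ge> - B\<^sup>2" for x
  proof -
    have "Re (f x) \<le> B * norm x"
      using bound[of x] complex_Re_le_cmod[of "f x"] by linarith
    moreover have "0 \<le> (norm x - B)\<^sup>2"
      by simp
    ultimately show ?thesis
      unfolding q_def power2_diff by (simp add: mult.commute)
  qed
  have bdd: "bdd_below (range q)"
    using lower by (auto intro!: bdd_belowI)
  define L where "L = Inf (range q)"
  have L: "L \<le> q x" for x
    unfolding L_def using bdd by (intro cInf_lower) auto
  define \<epsilon> where "\<epsilon> n = 1 / real (Suc n)" for n
  have "\<exists>x. q x < L + \<epsilon> n" for n
  proof -
    have "Inf (range q) < L + \<epsilon> n"
      by (simp add: L_def \<epsilon>_def)
    then show ?thesis
      using cInf_lessD[of "range q"] by blast
  qed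
  then obtain X where X: "\<And>n. q (X n) < L + \<epsilon> n"
    by metis
  have dist: "(norm (X m - X n))\<^sup>2 \<le> 2 * (\<epsilon> m + \<epsilon> n)" for m n
  proof -
    have "q (X m) + q (X n) - 2 * q ((1/2) *\<^sub>R (X m + X n))
        \<le> (L + \<epsilon> m) + (L + \<epsilon> n) - 2 * L"
      using X[of m] X[of n] L[of "(1/2) *\<^sub>R (X m + X n)"]
      by (intro diff_mono add_mono mult_left_mono) auto
    then show ?thesis
      unfolding cauchy by simp
  qed
  have "Cauchy X"
  proof (rule metric_CauchyI)
    fix e :: real
    assume e: "0 < e"
    obtain N where N: "\<epsilon> N < e\<^sup>2 / 4"
      using reals_Archimedean[of "e\<^sup>2 / 4"] e by (auto simp: inverse_eq_divide \<epsilon>_def)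
    show "\<exists>M. \<forall>m\<ge>M. \<forall>n\<ge>M. dist (X m) (X n) < e"
    proof (intro exI allI impI)
      fix m n
      assume "N \<le> m" "N \<le> n"
      then have "\<epsilon> m \<le> \<epsilon> N" "\<epsilon> n \<le> \<epsilon> N"
        by (simp_all add: frac_le \<epsilon>_def)
      then have "2 * (\<epsilon> m + \<epsilon> n) \<le> 2 * (\<epsilon> N + \<epsilon> N)"
        by simp
      also have "\<dots> < e\<^sup>2"
        using N by simp
      finally have "(norm (X m - X n))\<^sup>2 < e\<^sup>2"
        by (rule order_le_less_trans[OF dist])
      then show "dist (X m) (X n) < e"
        using e by (simp add: dist_norm power2_less_imp_less)
    qed
  qed
  then obtain y where y: "X \<longlonglongrightarrow> y"
    using Cauchy_convergent convergent_def by blast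
  have flim: "(\<lambda>n. f (X n)) \<longlonglongrightarrow> f y"
  proof -
    have "(\<lambda>n. B * norm (X n - y)) \<longlonglongrightarrow> B * 0"
      using y by (intro tendsto_intros) (simp add: LIM_zero tendsto_norm_zero)
    then have lim: "(\<lambda>n. B * norm (X n - y)) \<longlonglongrightarrow> 0"
      by simp
    have "(\<lambda>n. f (X n) - f y) \<longlonglongrightarrow> 0"
    proof (rule Lim_null_comparison[OF _ lim], rule always_eventually, rule allI)
      show "cmod (f (X n) - f y) \<le> B * norm (X n - y)" for n
        using bound[of "X n - y"] unfolding fdiff .
    qed
    then show ?thesis
      by (simp add: LIM_zero_cancel)
  qed
  have "(\<lambda>n. q (X n)) \<longlonglongrightarrow> q y"
    unfolding q_def using y flim by (intro tendsto_intros)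
  moreover have "(\<lambda>n. L + \<epsilon> n) \<longlonglongrightarrow> L"
    using tendsto_add[OF tendsto_const LIMSEQ_inverse_real_of_nat, of L]
    by (simp add: inverse_eq_divide \<epsilon>_def)
  ultimately have "q y \<le> L"
    using X by (intro LIMSEQ_le[of "\<lambda>n. q (X n)" _ "\<lambda>n. L + \<epsilon> n"]) (auto intro: less_imp_le)
  then have min: "q y \<le> q x" for x
    using L[of x] by linarith
  have Re: "Re (f h) = Re (cinner h y)" for h
  proof -
    \<comment> \<open>2 d is the derivative of \<open>q\<close> at y in direction h. The quadratic
      in t below is nonnegative everywhere, in particular at its vertex, which forces d = 0.\<close>
    define d where "d = Re (cinner h y) - Re (f h)"
    have *: "0 \<le> t\<^sup>2 * (norm h)\<^sup>2 + 2 * t * d" for t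
    proof -
      have "cinner y (t *\<^sub>R h) = complex_of_real t * cinner y h"
        by (simp add: scaleR_scaleC cinner_scaleC_right)
      then have "q (y + t *\<^sub>R h) = q y + (t\<^sup>2 * (norm h)\<^sup>2 + 2 * t * d)"
        by (simp add: q_def norm_add_square add fR d_def Re_cinner_commute[of y h] power_mult_distrib algebra_simps)
      then show ?thesis
        using min[of "y + t *\<^sub>R h"] by linarith
    qed
    have "d = 0"
    proof (cases "h = 0")
      case True
      then show ?thesis
        using *[of 1] *[of "-1"] by simp
    next
      case False
      define t where "t = - d / (norm h)\<^sup>2"
      have "t\<^sup>2 * (norm h)\<^sup>2 + 2 * t * d = - (d\<^sup>2 / (norm h)\<^sup>2)"
        using False by (simp add: t_def power_divide power2_eq_square field_simps)
      then have "d\<^sup>2 / (norm h)\<^sup>2 \<le> 0"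
        using *[of t] by linarith
      then show ?thesis
        using False by (simp add: divide_le_0_iff)
    qed
    then show ?thesis
      by (simp add: d_def)
  qed
  have "f h = cinner h y" for h
  proof (rule complex_eqI)
    \<comment> \<open>For both sides the real part at i h is minus the imaginary part at h.\<close>
    show "Im (f h) = Im (cinner h y)"
      using Re[of "\<i> *\<^sub>C h"] by (simp add: scale cinner_scaleC_left)
  qed (rule Re)
  then show ?thesis
    by blast
qed

lemma bounded_clinearI:
  assumes "\<And>x y. T (x + y) = T x + T y" "\<And>c x. T (c *\<^sub>C x) = c *\<^sub>C T x"
    "\<And>x. norm (T x) \<le> K * norm x"
  shows "bounded_clinear T"
  unfolding bounded_clinear_def
proof
  show "bounded_linear T"
    using assms by (intro bounded_linear_intro[where K = K]) (auto simp: scaleR_scaleC mult.commute)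
qed (use assms in blast)

lemma cadjoint_exists:
  fixes T :: "'a::complex_hilbert_space \<Rightarrow> 'a"
  assumes "bounded_clinear T"
  shows "\<exists>S. bounded_clinear S \<and> (\<forall>x y. cinner (T x) y = cinner x (S y))"
proof -
  interpret T: bounded_linear T
    using assms by (simp add: bounded_clinear_def)
  have TC: "T (c *\<^sub>C x) = c *\<^sub>C T x" for c x
    using assms by (simp add: bounded_clinear_def)
  obtain K where K: "K > 0" "\<And>x. norm (T x) \<le> norm x * K"
    using T.pos_bounded by blast
  have bd: "cmod (cinner (T x) y) \<le> (K * norm y) * norm x" for x y
  proof -
    have "norm (T x) * norm y \<le> (norm x * K) * norm y"
      using K(2) by (intro mult_right_mono) auto
    then show ?thesis
      using cinner_bound[of "T x" y] by (simp add: mult_ac)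
  qed
  have "\<exists>z. \<forall>x. cinner (T x) y = cinner x z" for y
    using bd by (intro riesz_representation[of "\<lambda>x. cinner (T x) y" "K * norm y"])
      (auto simp: T.add TC cinner_add_left cinner_scaleC_left)
  then obtain S where S: "\<And>x y. cinner (T x) y = cinner x (S y)"
    by metis
  have "bounded_clinear S"
  proof (rule bounded_clinearI[where K = K])
    show "S (x + y) = S x + S y" for x y
      by (rule cinner_eqI) (simp add: S[symmetric] cinner_add_right)
    show "S (c *\<^sub>C x) = c *\<^sub>C S x" for c x
      by (rule cinner_eqI) (simp add: S[symmetric] cinner_scaleC_right)
    show "norm (S y) \<le> K * norm y" for y
    proof (cases "S y = 0")
      case False
      have "norm (S y) * norm (S y) = cmod (cinner (T (S y)) y)"
        by (simp add: S cinner_self power2_eq_square norm_mult)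
      also have "\<dots> \<le> (K * norm y) * norm (S y)"
        by (rule bd)
      finally show ?thesis
        using False by simp
    qed (use K in simp)
  qed
  with S show ?thesis
    by blast
qed

lemma
  fixes T :: "'a::complex_hilbert_space \<Rightarrow> 'a"
  assumes "bounded_clinear T"
  shows bounded_clinear_cadjoint: "bounded_clinear (cadjoint T)"
    and cinner_cadjoint: "cinner (T x) y = cinner x (cadjoint T y)"
proof -
  obtain S where S: "bounded_clinear S" "\<And>x y. cinner (T x) y = cinner x (S y)"
    using cadjoint_exists[OF assms] by blast
  then have "cadjoint T = S"
    by (rule cadjoint_eqI)
  with S show "bounded_clinear (cadjoint T)" "cinner (T x) y = cinner x (cadjoint T y)"
    by auto
qed

lemma cinner_cadjoint_left:
  fixes T :: "'a::complex_hilbert_space \<Rightarrow> 'a"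
  assumes "bounded_clinear T"
  shows "cinner (cadjoint T x) y = cinner x (T y)"
  unfolding cinner_commute[of _ y] cinner_commute[of x] cinner_cadjoint[OF assms] ..

lemma norm_cadjoint_le:
  fixes T :: "'a::complex_hilbert_space \<Rightarrow> 'a"
  assumes T: "bounded_clinear T" and "\<And>x. norm (T x) \<le> K * norm x"
  shows "norm (cadjoint T x) \<le> K * norm x"
proof (cases "cadjoint T x = 0")
  case True
  have "0 \<le> K * norm x"
    by (rule order_trans[OF norm_ge_zero assms(2)])
  with True show ?thesis by simp
next
  case False
  have "norm (cadjoint T x) * norm (cadjoint T x) = cmod (cinner (T (cadjoint T x)) x)"
    by (simp add: cinner_cadjoint[OF T] cinner_self power2_eq_square norm_mult)
  also have "\<dots> \<le> norm (T (cadjoint T x)) * norm x"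
    by (rule cinner_bound)
  also have "\<dots> \<le> (K * norm (cadjoint T x)) * norm x"
    by (intro mult_right_mono assms) simp
  finally show ?thesis
    using False by (simp add: mult_ac)
qed

section \<open>Hyponormality as a comparison of norms\<close>

lemma hyponormal_iff:
  fixes T :: "'a::complex_hilbert_space \<Rightarrow> 'a"
  assumes T: "bounded_clinear T"
  shows "hyponormal T \<longleftrightarrow> (\<forall>x. norm (cadjoint T x) \<le> norm (T x))"
proof -
  have "cinner ((cadjoint T \<circ> T) x - (T \<circ> cadjoint T) x) x
      = complex_of_real ((norm (T x))\<^sup>2 - (norm (cadjoint T x))\<^sup>2)" for x
    by (simp add: cinner_diff_left cinner_cadjoint_left[OF T] cinner_cadjoint[OF T] cinner_self)
  then show ?thesis
    unfolding hyponormal_def positive_operator_def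
    by (simp add: power2_le_iff_abs_le del: of_real_diff of_real_power)
qed

text \<open>T - z has the same self-commutator as T. In the expanded squares the cross terms have
  equal real parts, which leaves the inequality for T.\<close>

lemma hyponormal_translate:
  fixes T :: "'a::complex_hilbert_space \<Rightarrow> 'a"
  assumes T: "bounded_clinear T" and "hyponormal T"
  shows "norm (cadjoint T x - cnj z *\<^sub>C x) \<le> norm (T x - z *\<^sub>C x)"
proof -
  have "cinner (cadjoint T x) (cnj z *\<^sub>C x) = cnj (cinner (T x) (z *\<^sub>C x))"
    by (simp add: cinner_scaleC_right cinner_cadjoint_left[OF T] cinner_commute[of x "T x"])
  then have "Re (cinner (cadjoint T x) (cnj z *\<^sub>C x)) = Re (cinner (T x) (z *\<^sub>C x))"
    by simp
  moreover have "(norm (cadjoint T x))\<^sup>2 \<le> (norm (T x))\<^sup>2"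
    using assms hyponormal_iff[OF T] by (intro power_mono) auto
  ultimately have "(norm (cadjoint T x - cnj z *\<^sub>C x))\<^sup>2 \<le> (norm (T x - z *\<^sub>C x))\<^sup>2"
    by (simp add: norm_diff_square norm_scaleC)
  then show ?thesis
    by (rule power2_le_imp_le) simp
qed

subsection \<open>Words in an operator and its adjoint\<close>

definition word :: "('b \<Rightarrow> 'b) list \<Rightarrow> 'b \<Rightarrow> 'b" where
  "word As = foldr (\<circ>) As id"

lemma word_Nil [simp]: "word [] x = x"
  by (simp add: word_def)

lemma word_Cons [simp]: "word (A # As) x = A (word As x)"
  by (simp add: word_def)

lemma word_append [simp]: "word (As @ Bs) x = word As (word Bs x)"
  by (induction As) simp_all

text \<open>\<open>J\<close> is the ideal generated by T. It collects operators with at least one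
  representation by a word containing T, so relations between words do no harm.\<close>

lemma SI_adjoint_word:
  assumes SI: "SI_semigroup (star_semigroup T)" and ne: "cadjoint T \<noteq> T"
  obtains As where "set As \<subseteq> {T, cadjoint T}" "2 \<le> length As" "cadjoint T = word As"
proof -
  define J where "J = {word As |As. T \<in> set As \<and> set As \<subseteq> {T, cadjoint T}}"
  have comp: "word As \<circ> word Bs = word (As @ Bs)" for As Bs :: "('a \<Rightarrow> 'a) list"
    by (rule ext) simp
  have S: "star_semigroup T = {word As |As. As \<noteq> [] \<and> set As \<subseteq> {T, cadjoint T}}"
    unfolding star_semigroup_def word_def ..
  have T: "T \<in> J"
  proof -
    have "T = word [T]"
      by (rule ext) simp
    moreover have "T \<in> set [T] \<and> set [T] \<subseteq> {T, cadjoint T}"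
      by simp
    ultimately show ?thesis
      unfolding J_def by blast
  qed
  have "semigroup_ideal J (star_semigroup T)"
    unfolding semigroup_ideal_def
  proof (intro conjI ballI)
    show "J \<noteq> {}"
      using T by blast
    show "J \<subseteq> star_semigroup T"
      unfolding S J_def by force
  next
    fix A X
    assume "A \<in> J" "X \<in> star_semigroup T"
    then obtain As Xs where *: "A = word As" "T \<in> set As" "set As \<subseteq> {T, cadjoint T}"
      "X = word Xs" "set Xs \<subseteq> {T, cadjoint T}"
      unfolding S J_def by blast
    have "T \<in> set (Xs @ As) \<and> set (Xs @ As) \<subseteq> {T, cadjoint T}"
      "T \<in> set (As @ Xs) \<and> set (As @ Xs) \<subseteq> {T, cadjoint T}"
      using * by auto
    then show "X \<circ> A \<in> J" "A \<circ> X \<in> J"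
      unfolding *(1,4) comp J_def by blast+
  qed
  then have "cadjoint T \<in> J"
    using SI T unfolding SI_semigroup_def by blast
  then obtain As where As: "T \<in> set As" "set As \<subseteq> {T, cadjoint T}" "cadjoint T = word As"
    unfolding J_def by blast
  \<comment> \<open>The only word of length at most 1 that contains T is T itself.\<close>
  have "2 \<le> length As"
  proof (rule ccontr)
    assume "\<not> 2 \<le> length As"
    with As(1) have "As = [T]"
      by (cases As; cases "tl As") auto
    with As(3) ne show False
      by (auto simp: fun_eq_iff)
  qed
  with As that show thesis
    by blast
qed

text \<open>Along u_k = X^k v the letter X moves u_k to u_(k+1), and the adjoint moves u_(k+1)
  asymptotically back to r^2 u_k, while the norm of u_k tends to r^k. Each letter thus multiplies
  the limiting norm by r. An adjoint letter needs an index of at least 1; starting at u_m with m at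
  least the length of the word guarantees this throughout.\<close>

lemma hyponormal_word_asymptotics:
  fixes X :: "'a::complex_hilbert_space \<Rightarrow> 'a" and v :: "nat \<Rightarrow> 'a"
  assumes X: "bounded_clinear X" and hyp: "hyponormal X"
    and le: "\<And>x. norm (X x) \<le> r * norm x" and r: "0 < r"
    and v1: "\<And>n. norm (v n) = 1" and vr: "(\<lambda>n. norm (X (v n))) \<longlonglongrightarrow> r"
    and As: "set As \<subseteq> {X, cadjoint X}" "length As \<le> m"
  shows "(\<lambda>n. norm (word As ((X ^^ m) (v n)))) \<longlonglongrightarrow> r ^ (m + length As)"
proof -
  let ?Y = "cadjoint X"
  have hypn: "norm (?Y x) \<le> norm (X x)" for x
    using hyp hyponormal_iff[OF X] by blast
  have leY: "norm (?Y x) \<le> r * norm x" for x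
    using norm_cadjoint_le[OF X le] .
  interpret X: bounded_linear X
    using X by (simp add: bounded_clinear_def)
  interpret Y: bounded_linear ?Y
    using bounded_clinear_cadjoint[OF X] by (simp add: bounded_clinear_def)
  \<comment> \<open>\<open>D x\<close> is the defect of x from attaining the norm bound r. By
    \<open>E\<close> a small defect makes x an approximate eigenvector of X followed by its adjoint;
    by \<open>DX\<close> the defect of X x is then small too.\<close>
  define D where "D x = r\<^sup>2 * (norm x)\<^sup>2 - (norm (X x))\<^sup>2" for x
  have D0: "0 \<le> D x" for x
    using power_mono[OF le[of x], of 2] by (simp add: D_def power_mult_distrib)
  have E: "(norm (?Y (X x) - r\<^sup>2 *\<^sub>R x))\<^sup>2 \<le> r\<^sup>2 * D x" for x
  proof -
    have "cinner (?Y (X x)) (r\<^sup>2 *\<^sub>R x) = complex_of_real (r\<^sup>2 * (norm (X x))\<^sup>2)"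
      by (simp add: scaleR_scaleC cinner_scaleC_right cinner_cadjoint_left[OF X] cinner_self)
    moreover have "(norm (?Y (X x)))\<^sup>2 \<le> r\<^sup>2 * (norm (X x))\<^sup>2"
      using power_mono[OF leY[of "X x"], of 2] by (simp add: power_mult_distrib)
    ultimately show ?thesis
      by (simp add: norm_diff_square D_def power_mult_distrib algebra_simps)
  qed
  \<comment> \<open>Hyponormality replaces \<open>norm (X (X x))\<close> by the smaller N, which
    differs from r^2 \<open>norm x\<close> by at most the error in \<open>E\<close>; the rest is a
    difference of squares.\<close>
  have DX: "D (X x) \<le> norm (?Y (X x) - r\<^sup>2 *\<^sub>R x) * (2 * r\<^sup>2 * norm x)" for x
  proof -
    define N where "N = norm (?Y (X x))"
    have N: "N \<le> r\<^sup>2 * norm x"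
      using order_trans[OF leY[of "X x"] mult_left_mono[OF le[of x]]] r
      by (simp add: N_def power2_eq_square mult_ac)
    have e: "r\<^sup>2 * norm x - N \<le> norm (?Y (X x) - r\<^sup>2 *\<^sub>R x)"
      using norm_triangle_ineq2[of "r\<^sup>2 *\<^sub>R x" "?Y (X x)"] r
      by (simp add: N_def norm_minus_commute)
    have "N\<^sup>2 \<le> (norm (X (X x)))\<^sup>2"
      using hypn[of "X x"] by (simp add: N_def power_mono)
    moreover have "r\<^sup>2 * (norm (X x))\<^sup>2 \<le> r\<^sup>2 * (r * norm x)\<^sup>2"
      by (intro mult_left_mono power_mono le) auto
    moreover have "r\<^sup>2 * (r * norm x)\<^sup>2 - N\<^sup>2 = (r\<^sup>2 * norm x - N) * (r\<^sup>2 * norm x + N)"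
      by (simp add: power2_eq_square algebra_simps)
    ultimately have "D (X x) \<le> (r\<^sup>2 * norm x - N) * (r\<^sup>2 * norm x + N)"
      unfolding D_def by linarith
    also have "\<dots> \<le> norm (?Y (X x) - r\<^sup>2 *\<^sub>R x) * (2 * r\<^sup>2 * norm x)"
      using N e by (intro mult_mono) (simp_all add: N_def mult.commute)
    finally show ?thesis .
  qed
  define u where "u k n = (X ^^ k) (v n)" for k n
  have uSuc: "u (Suc k) n = X (u k n)" for k n
    by (simp add: u_def)
  have ule: "norm (u k n) \<le> r ^ k" for k n
  proof (induction k)
    case 0
    then show ?case by (simp add: u_def v1)
  next
    case (Suc k)
    then show ?case
      unfolding uSuc using order_trans[OF le[of "u k n"] mult_left_mono[OF Suc]] r by simp
  qed
  have Dlim: "(\<lambda>n. D (u k n)) \<longlonglongrightarrow> 0"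
    and Elim: "(\<lambda>n. ?Y (u (Suc k) n) - r\<^sup>2 *\<^sub>R u k n) \<longlonglongrightarrow> 0" for k
  proof -
    have DE: "(\<lambda>n. ?Y (u (Suc k) n) - r\<^sup>2 *\<^sub>R u k n) \<longlonglongrightarrow> 0"
      if "(\<lambda>n. D (u k n)) \<longlonglongrightarrow> 0" for k
    proof (rule Lim_null_comparison)
      have "(\<lambda>n. sqrt (r\<^sup>2 * D (u k n))) \<longlonglongrightarrow> sqrt (r\<^sup>2 * 0)"
        using that by (intro tendsto_intros)
      then show "(\<lambda>n. sqrt (r\<^sup>2 * D (u k n))) \<longlonglongrightarrow> 0"
        by simp
      show "\<forall>\<^sub>F n in sequentially. norm (?Y (u (Suc k) n) - r\<^sup>2 *\<^sub>R u k n) \<le> sqrt (r\<^sup>2 * D (u k n))"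
        unfolding uSuc using E by (intro always_eventually allI real_le_rsqrt)
    qed
    show D: "(\<lambda>n. D (u k n)) \<longlonglongrightarrow> 0" for k
    proof (induction k)
      case 0
      have "(\<lambda>n. r\<^sup>2 * 1\<^sup>2 - (norm (X (v n)))\<^sup>2) \<longlonglongrightarrow> r\<^sup>2 * 1\<^sup>2 - r\<^sup>2"
        using vr by (intro tendsto_intros)
      then show ?case
        by (simp add: D_def u_def v1)
    next
      case (Suc k)
      have "(\<lambda>n. norm (?Y (u (Suc k) n) - r\<^sup>2 *\<^sub>R u k n) * (2 * r\<^sup>2 * r ^ k)) \<longlonglongrightarrow> norm (0::'a) * (2 * r\<^sup>2 * r ^ k)"
        using DE[OF Suc] by (intro tendsto_intros)
      then have lim: "(\<lambda>n. norm (?Y (u (Suc k) n) - r\<^sup>2 *\<^sub>R u k n) * (2 * r\<^sup>2 * r ^ k)) \<longlonglongrightarrow> 0"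
        by simp
      show ?case
      proof (rule tendsto_sandwich[OF _ _ tendsto_const lim]; rule always_eventually; rule allI)
        fix n
        show "0 \<le> D (u (Suc k) n)"
          by (rule D0)
        have "norm (?Y (u (Suc k) n) - r\<^sup>2 *\<^sub>R u k n) * (2 * r\<^sup>2 * norm (u k n))
            \<le> norm (?Y (u (Suc k) n) - r\<^sup>2 *\<^sub>R u k n) * (2 * r\<^sup>2 * r ^ k)"
          using ule[of k n] by (intro mult_left_mono) auto
        then show "D (u (Suc k) n) \<le> norm (?Y (u (Suc k) n) - r\<^sup>2 *\<^sub>R u k n) * (2 * r\<^sup>2 * r ^ k)"
          using DX[of "u k n"] unfolding uSuc by linarith
      qed
    qed
    show "(\<lambda>n. ?Y (u (Suc k) n) - r\<^sup>2 *\<^sub>R u k n) \<longlonglongrightarrow> 0"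
      by (rule DE[OF D])
  qed
  have ulim: "(\<lambda>n. norm (u k n)) \<longlonglongrightarrow> r ^ k" for k
  proof (induction k)
    case 0
    then show ?case by (simp add: u_def v1)
  next
    case (Suc k)
    have "(\<lambda>n. sqrt (r\<^sup>2 * (norm (u k n))\<^sup>2 - D (u k n))) \<longlonglongrightarrow> sqrt (r\<^sup>2 * (r ^ k)\<^sup>2 - 0)"
      using Suc Dlim by (intro tendsto_intros)
    moreover have "r\<^sup>2 * (r ^ k)\<^sup>2 - 0 = (r ^ Suc k)\<^sup>2"
      by (simp add: power_mult_distrib)
    moreover have "sqrt (r\<^sup>2 * (norm (u k n))\<^sup>2 - D (u k n)) = norm (u (Suc k) n)" for n
      by (simp add: D_def uSuc)
    ultimately show ?case
      using r by simp
  qed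
  \<comment> \<open>The power of r complements the norm r^k of u_k to the exponent m +
    \<open>length As\<close>. The bound k \<le> m + \<open>length As\<close> keeps the subtraction
    exact; m \<le> k + \<open>length As\<close> makes k positive whenever a further letter is still
    allowed.\<close>
  have "\<exists>k. k \<le> m + length As \<and> m \<le> k + length As \<and>
      (\<lambda>n. word As (u m n) - r ^ (m + length As - k) *\<^sub>R u k n) \<longlonglongrightarrow> 0"
    using As
  proof (induction As)
    case Nil
    show ?case
      by (intro exI[of _ m]) simp
  next
    case (Cons A As)
    then obtain k where k: "k \<le> m + length As" "m \<le> k + length As"
      and lim: "(\<lambda>n. word As (u m n) - r ^ (m + length As - k) *\<^sub>R u k n) \<longlonglongrightarrow> 0"
      by auto
    consider "A = X" | "A = ?Y"
      using Cons.prems by auto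
    then show ?case
    proof cases
      case 1
      have "(\<lambda>n. X (word As (u m n) - r ^ (m + length As - k) *\<^sub>R u k n)) \<longlonglongrightarrow> X 0"
        using lim by (rule X.tendsto)
      then have "(\<lambda>n. word (A # As) (u m n) - r ^ (m + length (A # As) - Suc k) *\<^sub>R u (Suc k) n) \<longlonglongrightarrow> 0"
        by (simp add: 1 X.diff X.scaleR X.zero uSuc)
      then show ?thesis
        using k by (intro exI[of _ "Suc k"]) auto
    next
      case 2
      obtain j where j: "k = Suc j"
        using k Cons.prems by (cases k) auto
      \<comment> \<open>The word gets one letter longer and the index drops by one, so the exponent
        rises by 2, which matches the factor r^2 in \<open>Elim\<close>.\<close>
      define c where "c = r ^ (m + length As - k)"
      have c: "r ^ (m + length (A # As) - j) = c * r\<^sup>2"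
      proof -
        have "m + length (A # As) - j = m + length As - k + 2"
          using k j by simp
        then show ?thesis
          unfolding c_def by (simp only: power_add)
      qed
      have "(\<lambda>n. ?Y (word As (u m n) - c *\<^sub>R u k n)
          + c *\<^sub>R (?Y (u (Suc j) n) - r\<^sup>2 *\<^sub>R u j n)) \<longlonglongrightarrow> ?Y 0 + c *\<^sub>R 0"
        using lim Elim unfolding c_def[symmetric] by (intro tendsto_intros Y.tendsto)
      then have "(\<lambda>n. word (A # As) (u m n) - r ^ (m + length (A # As) - j) *\<^sub>R u j n) \<longlonglongrightarrow> 0"
        unfolding c by (simp add: 2 Y.diff Y.scaleR Y.zero j scaleR_diff_right)
      then show ?thesis
        using k j by (intro exI[of _ j]) auto
    qed
  qed
  then obtain k where k: "k \<le> m + length As"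
    and lim: "(\<lambda>n. word As (u m n) - r ^ (m + length As - k) *\<^sub>R u k n) \<longlonglongrightarrow> 0"
    by blast
  define c where "c = r ^ (m + length As - k)"
  have "c * r ^ k = r ^ (m + length As)"
    using k by (simp add: c_def power_add[symmetric])
  moreover have "(\<lambda>n. c * norm (u k n)) \<longlonglongrightarrow> c * r ^ k"
    by (intro tendsto_intros ulim)
  ultimately have clim: "(\<lambda>n. norm (c *\<^sub>R u k n)) \<longlonglongrightarrow> r ^ (m + length As)"
    using r by (simp add: c_def)
  have "(\<lambda>n. norm (word As (u m n)) - norm (c *\<^sub>R u k n)) \<longlonglongrightarrow> 0"
  proof (rule Lim_null_comparison)
    show "(\<lambda>n. norm (word As (u m n) - c *\<^sub>R u k n)) \<longlonglongrightarrow> 0"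
      using lim unfolding c_def by (rule tendsto_norm_zero)
    show "\<forall>\<^sub>F n in sequentially. norm (norm (word As (u m n)) - norm (c *\<^sub>R u k n))
        \<le> norm (word As (u m n) - c *\<^sub>R u k n)"
      by (rule always_eventually) (simp only: real_norm_def norm_triangle_ineq3 simp_thms)
  qed
  from tendsto_add[OF this clim] show ?thesis
    by (simp add: u_def)
qed

text \<open>On vectors that almost attain \<open>r = \<parallel>X\<parallel>\<close> every letter of a word scales the norm by \<open>r\<close>,
  so an adjoint equal to a word of length \<open>n \<ge> 2\<close> forces \<open>r = r\<^sup>n\<close>.\<close>

lemma contraction_of_adjoint_word:
  fixes X :: "'a::complex_hilbert_space \<Rightarrow> 'a"
  assumes X: "bounded_clinear X" and hyp: "hyponormal X"
    and As: "set As \<subseteq> {X, cadjoint X}" "2 \<le> length As" "cadjoint X = word As"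
  shows "norm (X x) \<le> norm x"
proof -
  define r where "r = onorm X"
  interpret X: bounded_linear X
    using X by (simp add: bounded_clinear_def)
  have le: "norm (X x) \<le> r * norm x" for x
    unfolding r_def by (rule onorm[OF X.bounded_linear_axioms])
  have "r \<le> 1"
  proof (rule ccontr)
    assume "\<not> r \<le> 1"
    then have r: "1 < r"
      by simp
    have "\<exists>v. norm v = 1 \<and> r - inverse (real (Suc n)) < norm (X v)" for n
    proof (rule ccontr)
      assume *: "\<not> ?thesis"
      \<comment> \<open>If no unit vector exceeded b, then b would bound the operator norm. It is
        nonnegative because r > 1.\<close>
      define b where "b = r - inverse (real (Suc n))"
      have "inverse (real (Suc n)) \<le> 1"
        by (simp add: field_simps)
      then have b: "0 \<le> b" "b < r"
        using r by (auto simp: b_def)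
      have "norm (X x) \<le> b * norm x" for x
      proof (cases "x = 0")
        case False
        have "norm (X (inverse (norm x) *\<^sub>R x)) \<le> b"
          using * False unfolding b_def[symmetric] by (auto simp: not_less)
        then show ?thesis
          using False by (simp add: X.scaleR field_simps)
      qed (simp add: X.zero)
      then have "r \<le> b"
        unfolding r_def by (intro onorm_bound b)
      with b show False
        by simp
    qed
    then obtain v where v: "\<And>n. norm (v n) = 1" "\<And>n. r - inverse (real (Suc n)) < norm (X (v n))"
      by metis
    have "(\<lambda>n. r - inverse (real (Suc n))) \<longlonglongrightarrow> r - 0"
      by (intro tendsto_intros LIMSEQ_inverse_real_of_nat)
    then have lower: "(\<lambda>n. r - inverse (real (Suc n))) \<longlonglongrightarrow> r"
      by simp
    have vr: "(\<lambda>n. norm (X (v n))) \<longlonglongrightarrow> r"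
    proof (rule tendsto_sandwich[OF _ _ lower tendsto_const]; rule always_eventually; rule allI)
      show "r - inverse (real (Suc n)) \<le> norm (X (v n))" for n
        using v(2)[of n] by simp
      show "norm (X (v n)) \<le> r" for n
        using le[of "v n"] v(1) by simp
    qed
    have asym: "(\<lambda>n. norm (word Bs ((X ^^ length As) (v n)))) \<longlonglongrightarrow> r ^ (length As + length Bs)"
      if "set Bs \<subseteq> {X, cadjoint X}" "length Bs \<le> length As" for Bs
      using r by (intro hyponormal_word_asymptotics[OF X hyp le _ v(1) vr that]) simp
    \<comment> \<open>The adjoint is evaluated on the same vectors both as a single letter and as
      the word \<open>As\<close>. With l = \<open>length As\<close> the limits are r^(l + 1) and
      r^(l + l), which agree only for l = 1.\<close>
    have "(\<lambda>n. norm (cadjoint X ((X ^^ length As) (v n)))) \<longlonglongrightarrow> r ^ (length As + 1)"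
      using asym[of "[cadjoint X]"] As(2) by simp
    moreover have "(\<lambda>n. norm (cadjoint X ((X ^^ length As) (v n)))) \<longlonglongrightarrow> r ^ (length As + length As)"
      unfolding As(3) by (rule asym[OF As(1) order_refl])
    ultimately have "r ^ (length As + 1) = r ^ (length As + length As)"
      by (rule LIMSEQ_unique)
    then have "length As + 1 = length As + length As"
      using r by (simp only: power_inject_exp)
    with As(2) show False
      by simp
  qed
  then show ?thesis
    using order_trans[OF le[of x] mult_right_mono[of r 1 "norm x"]] by simp
qed

subsection \<open>The spectrum\<close>

text \<open>The letters are contractions and the accumulated scalar has modulus at most 1, so each
  letter adds at most \<epsilon> to the error. The modulus of c depends only on the length of the
  word, not on the arrangement of its letters.\<close>

lemma word_approx_eigenvector:
  fixes T S :: "'a::complex_hilbert_space \<Rightarrow> 'a"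
  assumes lin: "bounded_clinear T" "bounded_clinear S"
    and le: "\<And>y. norm (T y) \<le> norm y" "\<And>y. norm (S y) \<le> norm y"
    and close: "norm (T x - z *\<^sub>C x) \<le> \<epsilon>" "norm (S x - cnj z *\<^sub>C x) \<le> \<epsilon>"
    and z: "cmod z \<le> 1" and As: "set As \<subseteq> {T, S}"
  shows "\<exists>c. cmod c = cmod z ^ length As \<and> norm (word As x - c *\<^sub>C x) \<le> real (length As) * \<epsilon>"
  using As
proof (induction As)
  case Nil
  show ?case
    by (intro exI[of _ 1]) (simp add: scaleC_one)
next
  case (Cons A As)
  then obtain c where c: "cmod c = cmod z ^ length As"
    "norm (word As x - c *\<^sub>C x) \<le> real (length As) * \<epsilon>"
    by auto
  obtain a where A: "bounded_clinear A" "\<And>y. norm (A y) \<le> norm y"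
    "cmod a = cmod z" "norm (A x - a *\<^sub>C x) \<le> \<epsilon>"
  proof (cases "A = T")
    case True
    with lin le close that[of z] show ?thesis by simp
  next
    case False
    with Cons.prems have "A = S" by simp
    with lin le close that[of "cnj z"] show ?thesis by simp
  qed
  interpret A: bounded_linear A
    using A(1) by (simp add: bounded_clinear_def)
  have AC: "A (k *\<^sub>C y) = k *\<^sub>C A y" for k y
    using A(1) by (simp add: bounded_clinear_def)
  have "word (A # As) x - (c * a) *\<^sub>C x = A (word As x - c *\<^sub>C x) + c *\<^sub>C (A x - a *\<^sub>C x)"
    by (simp add: A.diff AC scaleC_diff_right scaleC_scaleC)
  also have "norm \<dots> \<le> norm (A (word As x - c *\<^sub>C x)) + norm (c *\<^sub>C (A x - a *\<^sub>C x))"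
    by (rule norm_triangle_ineq)
  also have "\<dots> \<le> real (length As) * \<epsilon> + 1 * \<epsilon>"
  proof (rule add_mono)
    show "norm (A (word As x - c *\<^sub>C x)) \<le> real (length As) * \<epsilon>"
      using A(2) c(2) by (rule order_trans)
    have "cmod c \<le> 1"
      using z by (simp add: c(1) power_le_one)
    then show "norm (c *\<^sub>C (A x - a *\<^sub>C x)) \<le> 1 * \<epsilon>"
      unfolding norm_scaleC using A(4) by (intro mult_mono) auto
  qed
  finally have "norm (word (A # As) x - (c * a) *\<^sub>C x) \<le> real (length (A # As)) * \<epsilon>"
    by (simp add: algebra_simps)
  then show ?case
    using c(1) A(3) by (intro exI[of _ "c * a"]) (simp add: norm_mult mult.commute)
qed

text \<open>With \<epsilon> the norm of T x - z x, the adjoint maps x to within \<epsilon> of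
  \<open>cnj z\<close> times x and, read as a word of length n, to within n \<epsilon> of c x with
  |c| = |z|^n. The two scalars differ by at least |z| - |z|^n.\<close>

lemma bounded_below_of_adjoint_word:
  fixes T :: "'a::complex_hilbert_space \<Rightarrow> 'a"
  assumes T: "bounded_clinear T" and hyp: "hyponormal T"
    and le: "\<And>y. norm (T y) \<le> norm y"
    and As: "set As \<subseteq> {T, cadjoint T}" "2 \<le> length As" "cadjoint T = word As"
    and z: "cmod z \<le> 1"
  shows "cmod z * (1 - cmod z) * norm x \<le> (real (length As) + 1) * norm (T x - z *\<^sub>C x)"
proof -
  define \<epsilon> where "\<epsilon> = norm (T x - z *\<^sub>C x)"
  have leY: "norm (cadjoint T y) \<le> norm y" for y
    using norm_cadjoint_le[OF T, of 1] le by simp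
  have adj: "norm (cadjoint T x - cnj z *\<^sub>C x) \<le> \<epsilon>"
    unfolding \<epsilon>_def by (rule hyponormal_translate[OF T hyp])
  obtain c where c: "cmod c = cmod z ^ length As"
    "norm (word As x - c *\<^sub>C x) \<le> real (length As) * \<epsilon>"
    using word_approx_eigenvector[OF T bounded_clinear_cadjoint[OF T] le leY _ adj z As(1)]
    unfolding \<epsilon>_def by auto
  \<comment> \<open>Here n \<ge> 2 is used; the exponent 2 gives a factor that is the same for all
    words and is positive on the punctured disc.\<close>
  have "cmod z ^ length As \<le> cmod z ^ 2"
    using z As(2) by (intro power_decreasing) auto
  then have "cmod z * (1 - cmod z) \<le> cmod (cnj z) - cmod c"
    by (simp add: c(1) algebra_simps power2_eq_square)
  also have "\<dots> \<le> cmod (cnj z - c)"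
    by (rule norm_triangle_ineq2)
  finally have "cmod z * (1 - cmod z) * norm x \<le> cmod (cnj z - c) * norm x"
    by (rule mult_right_mono) simp
  also have "\<dots> = norm ((word As x - c *\<^sub>C x) - (cadjoint T x - cnj z *\<^sub>C x))"
    by (simp add: As(3)[symmetric] norm_scaleC[symmetric] scaleC_diff_left)
  also have "\<dots> \<le> real (length As) * \<epsilon> + \<epsilon>"
    using norm_triangle_ineq4 add_mono[OF c(2) adj] by (rule order_trans)
  finally show ?thesis
    unfolding \<epsilon>_def[symmetric] by (simp add: algebra_simps)
qed

section \<open>Lower bounds, invertibility and the boundary of the spectrum\<close>

lemma bounded_clinear_translate:
  assumes "bounded_clinear T"
  shows "bounded_clinear (\<lambda>x. T x - z *\<^sub>C x)"
proof -
  interpret T: bounded_linear T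
    using assms by (simp add: bounded_clinear_def)
  obtain K where K: "\<And>x. norm (T x) \<le> norm x * K"
    using T.bounded by blast
  show ?thesis
  proof (rule bounded_clinearI[where K = "K + cmod z"])
    show "norm (T x - z *\<^sub>C x) \<le> (K + cmod z) * norm x" for x
      using norm_triangle_ineq4[of "T x" "z *\<^sub>C x"] K[of x]
      by (simp add: norm_scaleC algebra_simps)
  qed (use assms in \<open>simp_all add: bounded_clinear_def T.add scaleC_add_right scaleC_diff_right
      scaleC_scaleC mult.commute\<close>)
qed

lemma invertible_operatorI:
  fixes A :: "'a::complex_hilbert_space \<Rightarrow> 'a"
  assumes A: "bounded_clinear A" and "surj A" and c: "0 < c" "\<And>x. c * norm x \<le> norm (A x)"
  shows "invertible_operator A"
proof -
  interpret A: bounded_linear A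
    using A by (simp add: bounded_clinear_def)
  have AC: "A (k *\<^sub>C x) = k *\<^sub>C A x" for k x
    using A by (simp add: bounded_clinear_def)
  have inj: "x = y" if "A x = A y" for x y
    using c(2)[of "x - y"] c(1) that by (simp add: A.diff mult_le_0_iff)
  define B where "B = inv A"
  have AB: "A (B y) = y" for y
    unfolding B_def using \<open>surj A\<close> by (rule surj_f_inv_f)
  have BA: "B (A x) = x" for x
    by (rule inj) (rule AB)
  have "bounded_clinear B"
  proof (rule bounded_clinearI[where K = "1 / c"])
    show "B (x + y) = B x + B y" for x y
      by (rule inj) (simp add: A.add AB)
    show "B (k *\<^sub>C x) = k *\<^sub>C B x" for k x
      by (rule inj) (simp add: AC AB)
    show "norm (B x) \<le> 1 / c * norm x" for x
      using c(2)[of "B x"] c(1) by (simp add: AB field_simps)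
  qed
  moreover have "A \<circ> B = id" "B \<circ> A = id"
    by (simp_all add: fun_eq_iff AB BA)
  ultimately show ?thesis
    unfolding invertible_operator_def by blast
qed

lemma not_in_spectrumD:
  fixes T :: "'a::complex_hilbert_space \<Rightarrow> 'a"
  assumes "z \<notin> spectrum T"
  shows "surj (\<lambda>x. T x - z *\<^sub>C x)"
proof -
  obtain B where "(\<lambda>x. T x - z *\<^sub>C x) \<circ> B = id"
    using assms unfolding spectrum_def invertible_operator_def by blast
  then have "T (B y) - z *\<^sub>C B y = y" for y
    by (auto simp: fun_eq_iff)
  then show ?thesis
    by (rule surjI)
qed

text \<open>A x - d x = y is the fixed point equation x = inv A (y + d x), and the lower bound makes
  its right side contract with factor |d| / c.\<close>

lemma surj_translate:
  fixes A :: "'a::complex_hilbert_space \<Rightarrow> 'a"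
  assumes A: "bounded_clinear A" and surj: "surj A"
    and c: "\<And>x. c * norm x \<le> norm (A x)" and d: "cmod d < c"
  shows "surj (\<lambda>x. A x - d *\<^sub>C x)"
proof (rule surjI)
  fix y
  interpret A: bounded_linear A
    using A by (simp add: bounded_clinear_def)
  have c0: "0 < c"
    using d norm_ge_zero[of d] by linarith
  define g where "g x = inv A (y + d *\<^sub>C x)" for x
  have Ag: "A (g x) = y + d *\<^sub>C x" for x
    unfolding g_def using surj by (rule surj_f_inv_f)
  have "dist (g x) (g x') \<le> cmod d / c * dist x x'" for x x'
  proof -
    have "c * norm (g x - g x') \<le> norm (d *\<^sub>C (x - x'))"
      using c[of "g x - g x'"] by (simp add: A.diff Ag scaleC_diff_right)
    then show ?thesis
      using c0 by (simp add: dist_norm norm_scaleC field_simps)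
  qed
  moreover have "0 \<le> cmod d / c" "cmod d / c < 1"
    using c0 d by simp_all
  ultimately have "\<exists>!x. g x = x"
    using banach_fix_type[of "cmod d / c" g] by blast
  then have "\<exists>x. g x = x"
    by blast
  then have "g (SOME x. g x = x) = (SOME x. g x = x)"
    by (rule someI_ex)
  \<comment> \<open>The right inverse must be a function of y, so the fixed point is written out
    with \<open>g\<close> unfolded, since \<open>g\<close> itself depends on y.\<close>
  then show "A (SOME x. inv A (y + d *\<^sub>C x) = x) - d *\<^sub>C (SOME x. inv A (y + d *\<^sub>C x) = x) = y"
    using Ag[of "SOME x. g x = x"] by (simp add: g_def)
qed

text \<open>Quantitative openness of the resolvent set: the cleared disc has radius c, which does
  not shrink as w approaches a boundary point where T - z is bounded below.\<close>

lemma not_in_spectrum_translate: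
  fixes T :: "'a::complex_hilbert_space \<Rightarrow> 'a"
  assumes T: "bounded_clinear T" and w: "w \<notin> spectrum T"
    and c: "\<And>x. c * norm x \<le> norm (T x - w *\<^sub>C x)" and d: "cmod (z - w) < c"
  shows "z \<notin> spectrum T"
proof -
  have eq: "T x - z *\<^sub>C x = (T x - w *\<^sub>C x) - (z - w) *\<^sub>C x" for x
    by (simp add: scaleC_diff_left)
  have "invertible_operator (\<lambda>x. T x - z *\<^sub>C x)"
  proof (rule invertible_operatorI[where c = "c - cmod (z - w)"])
    show "bounded_clinear (\<lambda>x. T x - z *\<^sub>C x)"
      by (rule bounded_clinear_translate[OF T])
    show "surj (\<lambda>x. T x - z *\<^sub>C x)"
      unfolding eq
      by (rule surj_translate[OF bounded_clinear_translate[OF T] not_in_spectrumD[OF w] c d])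
    show "(c - cmod (z - w)) * norm x \<le> norm (T x - z *\<^sub>C x)" for x
      using norm_triangle_ineq2[of "T x - w *\<^sub>C x" "(z - w) *\<^sub>C x"] c[of x]
      unfolding eq by (simp add: norm_scaleC left_diff_distrib)
  qed (use d in simp)
  then show ?thesis
    by (simp add: spectrum_def)
qed

text \<open>The boundary of the spectrum consists of approximate eigenvalues. A resolvent point w
  within c/4 of z inherits the lower bound c/2, so the disc of radius c/2 about w is free of
  spectrum, and it contains the disc of radius c/4 about z.\<close>

lemma frontier_spectrum_not_bounded_below:
  fixes T :: "'a::complex_hilbert_space \<Rightarrow> 'a"
  assumes T: "bounded_clinear T" and z: "z \<in> frontier (spectrum T)"
    and c: "0 < c" "\<And>x. c * norm x \<le> norm (T x - z *\<^sub>C x)"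
  shows False
proof -
  have "z \<in> closure (- spectrum T)"
    using z by (simp add: frontier_closures)
  then obtain w where w: "w \<notin> spectrum T" "dist w z < c / 4"
    using c(1) unfolding closure_approachable by (metis ComplD zero_less_divide_iff zero_less_numeral)
  have cw: "c / 2 * norm x \<le> norm (T x - w *\<^sub>C x)" for x
  proof -
    have eq: "T x - w *\<^sub>C x = (T x - z *\<^sub>C x) - (w - z) *\<^sub>C x"
      by (simp add: scaleC_diff_left)
    have "cmod (w - z) * norm x \<le> c / 2 * norm x"
      using w c(1) by (intro mult_right_mono) (auto simp: dist_norm)
    then show ?thesis
      using norm_triangle_ineq2[of "T x - z *\<^sub>C x" "(w - z) *\<^sub>C x"] c(2)[of x]
      unfolding eq norm_scaleC by simp
  qed
  have "u \<notin> spectrum T" if "dist u z < c / 4" for u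
  proof (rule not_in_spectrum_translate[OF T w(1) cw])
    show "cmod (u - w) < c / 2"
      using dist_triangle2[of u w z] that w(2) by (simp add: dist_norm)
  qed
  then have "z \<notin> closure (spectrum T)"
    unfolding closure_approachable using c(1) by (auto intro!: exI[of _ "c / 4"])
  with z show False
    by (simp add: frontier_def)
qed

lemma not_in_spectrum_of_contraction:
  fixes T :: "'a::complex_hilbert_space \<Rightarrow> 'a"
  assumes T: "bounded_clinear T" and le: "\<And>y. norm (T y) \<le> norm y" and z: "1 < cmod z"
  shows "z \<notin> spectrum T"
proof -
  interpret T: bounded_linear T
    using T by (simp add: bounded_clinear_def)
  have nz: "z \<noteq> 0"
    using z by auto
  have "surj (\<lambda>x. - (z *\<^sub>C x) + T x)"
  proof (rule surjI)
    fix y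
    \<comment> \<open>Fixed points of \<open>g\<close> solve T x - z x = y.\<close>
    define g where "g x = inverse z *\<^sub>C (T x - y)" for x
    have "dist (g x) (g x') \<le> inverse (cmod z) * dist x x'" for x x'
    proof -
      have "norm (T (x - x')) \<le> norm (x - x')"
        by (rule le)
      then show ?thesis
        using z by (simp add: g_def dist_norm norm_scaleC scaleC_diff_right[symmetric]
            norm_inverse T.diff mult_left_mono)
    qed
    moreover have "0 \<le> inverse (cmod z)" "inverse (cmod z) < 1"
      using z by (simp_all add: inverse_less_1_iff)
    ultimately have "\<exists>x. g x = x"
      using banach_fix_type[of "inverse (cmod z)" g] by blast
    then have "g (SOME x. g x = x) = (SOME x. g x = x)"
      by (rule someI_ex)
    then have "z *\<^sub>C g (SOME x. g x = x) = z *\<^sub>C (SOME x. g x = x)"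
      by simp
    moreover have "z *\<^sub>C g x = T x - y" for x
      using nz by (simp add: g_def scaleC_scaleC scaleC_one)
    ultimately have "T (SOME x. g x = x) - y = z *\<^sub>C (SOME x. g x = x)"
      by simp
    then show "- (z *\<^sub>C (SOME x. inverse z *\<^sub>C (T x - y) = x)) + T (SOME x. inverse z *\<^sub>C (T x - y) = x) = y"
      unfolding g_def by (simp add: algebra_simps)
  qed
  then have surj: "surj (\<lambda>x. T x - z *\<^sub>C x)"
    by simp
  have "invertible_operator (\<lambda>x. T x - z *\<^sub>C x)"
  proof (rule invertible_operatorI[OF bounded_clinear_translate[OF T] surj])
    show "0 < cmod z - 1"
      using z by simp
    show "(cmod z - 1) * norm x \<le> norm (T x - z *\<^sub>C x)" for x
      using norm_triangle_ineq2[of "z *\<^sub>C x" "T x"] le[of x]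
      by (simp add: norm_scaleC norm_minus_commute left_diff_distrib)
  qed
  then show ?thesis
    by (simp add: spectrum_def)
qed

text \<open>The connected punctured disc misses the boundary of the spectrum, so it lies inside or
  outside as a whole. Inside, it would put \<open>z0\<close> into the closure and hence the interior
  of the spectrum, although points just beyond the unit circle are regular for a
  contraction.\<close>

lemma punctured_disc_not_in_spectrum:
  fixes T :: "'a::complex_hilbert_space \<Rightarrow> 'a"
  assumes T: "bounded_clinear T" and le: "\<And>y. norm (T y) \<le> norm y"
    and below: "\<And>z. z \<noteq> 0 \<Longrightarrow> cmod z < 1 \<Longrightarrow> \<exists>c>0. \<forall>x. c * norm x \<le> norm (T x - z *\<^sub>C x)"
    and z0: "cmod z0 = 1" "z0 \<notin> frontier (spectrum T)"
    and z: "z \<noteq> 0" "cmod z < 1"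
  shows "z \<notin> spectrum T"
proof
  assume zs: "z \<in> spectrum T"
  define U where "U = ball (0::complex) 1 - {0}"
  have "connected U"
    unfolding U_def by (rule connected_punctured_ball) simp
  moreover have "U \<inter> frontier (spectrum T) = {}"
    using below frontier_spectrum_not_bounded_below[OF T] by (fastforce simp: U_def)
  moreover have "U \<inter> spectrum T \<noteq> {}"
    using zs z by (auto simp: U_def)
  ultimately have sub: "U \<subseteq> spectrum T"
    using connected_Int_frontier[of U "spectrum T"] by blast
  have "z0 \<in> closure (spectrum T)"
    unfolding closure_approachable
  proof (intro allI impI)
    fix e :: real
    assume e: "0 < e"
    define t where "t = min (e / 2) (1 / 2)"
    have t: "0 < t" "t < e" "t < 1"
      using e by (auto simp: t_def)
    have "z0 - complex_of_real t * z0 = complex_of_real (1 - t) * z0"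
      by (simp add: algebra_simps)
    then have "cmod (z0 - complex_of_real t * z0) = 1 - t"
      using t z0(1) by (simp only: norm_mult norm_of_real) simp
    then have "z0 - complex_of_real t * z0 \<in> U"
      using t by (auto simp: U_def)
    moreover have "dist (z0 - complex_of_real t * z0) z0 < e"
      using t z0(1) by (simp add: dist_norm norm_mult)
    ultimately show "\<exists>y\<in>spectrum T. dist y z0 < e"
      using sub by blast
  qed
  with z0(2) have "z0 \<in> interior (spectrum T)"
    by (simp add: frontier_def)
  then obtain e where e: "0 < e" "ball z0 e \<subseteq> spectrum T"
    unfolding mem_interior by blast
  define u where "u = complex_of_real (1 + e / 2) * z0"
  have "cmod u = 1 + e / 2"
    using e(1) z0(1) by (simp only: u_def norm_mult norm_of_real) simp
  then have "u \<notin> spectrum T"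
    using e(1) by (intro not_in_spectrum_of_contraction[OF T le]) simp
  moreover have "u \<in> ball z0 e"
  proof -
    have "z0 - u = - (complex_of_real (e / 2) * z0)"
      by (simp add: u_def algebra_simps)
    then have "dist z0 u = e / 2"
      using e(1) z0(1) by (simp add: dist_norm norm_mult)
    then show ?thesis
      using e(1) by simp
  qed
  ultimately show False
    using e(2) by blast
qed

subsection \<open>Inverting a hyponormal operator off its kernel\<close>

lemma bounded_linear_scaleC: "bounded_linear (\<lambda>x::'a::complex_hilbert_space. c *\<^sub>C x)"
  by (rule bounded_linear_intro[where K = "cmod c"])
    (simp_all add: scaleC_add_right scaleR_scaleC scaleC_scaleC norm_scaleC mult.commute)

text \<open>For \<open>v = T u\<close> with \<open>u\<close> in the range of \<open>T\<close>, the function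
  \<open>z \<mapsto> \<langle>(T - z)\<^sup>-\<^sup>1 v, y\<rangle>\<close> extends holomorphically to \<open>0\<close> with value \<open>\<langle>u, y\<rangle>\<close>, and the maximum
  modulus principle transports the resolvent bound from the circle of radius \<open>1/2\<close> to \<open>0\<close>.\<close>

lemma range_bounded_below:
  fixes T :: "'a::complex_hilbert_space \<Rightarrow> 'a"
  assumes T: "bounded_clinear T" and C: "0 < C"
    and below: "\<And>z x. cmod z < 1 \<Longrightarrow> cmod z * (1 - cmod z) * norm x \<le> C * norm (T x - z *\<^sub>C x)"
    and spec: "\<And>z. z \<noteq> 0 \<Longrightarrow> cmod z < 1 \<Longrightarrow> z \<notin> spectrum T"
    and u: "u \<in> range T"
  shows "norm u \<le> 4 * C * norm (T u)"
proof (cases "u = 0")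
  case False
  interpret T: bounded_linear T
    using T by (simp add: bounded_clinear_def)
  have TC: "T (k *\<^sub>C x) = k *\<^sub>C T x" for k x
    using T by (simp add: bounded_clinear_def)
  obtain p where p: "u = T p"
    using u by blast
  define U where "U = ball (0::complex) 1 - {0}"
  define R where "R z = inv (\<lambda>x. T x - z *\<^sub>C x)" for z
  have U: "z \<noteq> 0" "cmod z < 1" "0 < cmod z * (1 - cmod z)" if "z \<in> U" for z
    using that by (auto simp: U_def)
  have openU: "open U"
    unfolding U_def by (intro open_delete open_ball)
  have R: "T (R z x) - z *\<^sub>C R z x = x" if "z \<in> U" for z x
    using surj_f_inv_f[OF not_in_spectrumD[OF spec[OF U(1,2)[OF that]]]] by (simp add: R_def)
  have Rbd: "cmod z * (1 - cmod z) * norm (R z x) \<le> C * norm x" if "z \<in> U" for z x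
    using below[OF U(2)[OF that], of "R z x"] R[OF that] by simp
  have Runiq: "R z (T x - z *\<^sub>C x) = x" if z: "z \<in> U" for z x
  proof -
    define d where "d = R z (T x - z *\<^sub>C x) - x"
    have "T d - z *\<^sub>C d = 0"
      using R[OF z, of "T x - z *\<^sub>C x"] by (simp add: d_def T.diff scaleC_diff_right algebra_simps)
    then have "cmod z * (1 - cmod z) * norm d \<le> 0"
      using below[OF U(2)[OF z], of d] by simp
    then have "norm d \<le> 0"
      using U[OF z] by (auto simp: mult_le_0_iff)
    then show ?thesis
      by (simp add: d_def)
  qed
  have resolvent: "R z x - R a x = (z - a) *\<^sub>C R z (R a x)" if z: "z \<in> U" and a: "a \<in> U" for z a x
  proof -
    have "R z x = R a x + (z - a) *\<^sub>C R z (R a x)"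
    proof (subst Runiq[OF z, symmetric], rule arg_cong[where f = "R z"])
      have "T (R a x + (z - a) *\<^sub>C R z (R a x)) - z *\<^sub>C (R a x + (z - a) *\<^sub>C R z (R a x))
          = T (R a x) - z *\<^sub>C R a x
            + (z - a) *\<^sub>C (T (R z (R a x)) - z *\<^sub>C R z (R a x))"
        by (simp add: T.add TC scaleC_add_right scaleC_diff_right scaleC_scaleC mult.commute)
      also have "\<dots> = T (R a x) - a *\<^sub>C R a x"
        unfolding R[OF z] by (simp add: scaleC_diff_left)
      finally show "x = T (R a x + (z - a) *\<^sub>C R z (R a x))
          - z *\<^sub>C (R a x + (z - a) *\<^sub>C R z (R a x))"
        by (simp add: R[OF a])
    qed
    then show ?thesis
      by (simp add: algebra_simps)
  qed
  have Rcont: "((\<lambda>z. R z x) \<longlongrightarrow> R a x) (at a)" if a: "a \<in> U" for a x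
  proof (rule LIM_zero_cancel, rule Lim_null_comparison)
    have "((\<lambda>z. cmod (z - a) * (C * norm (R a x) / (cmod z * (1 - cmod z))))
        \<longlongrightarrow> cmod (a - a) * (C * norm (R a x) / (cmod a * (1 - cmod a)))) (at a)"
      using U(3)[OF a] by (intro tendsto_intros) auto
    then show "((\<lambda>z. cmod (z - a) * (C * norm (R a x) / (cmod z * (1 - cmod z)))) \<longlongrightarrow> 0) (at a)"
      by simp
    have "norm (R z x - R a x) \<le> cmod (z - a) * (C * norm (R a x) / (cmod z * (1 - cmod z)))"
      if z: "z \<in> U" for z
      unfolding resolvent[OF z a] norm_scaleC
      using Rbd[OF z, of "R a x"] U(3)[OF z] by (intro mult_left_mono) (simp_all add: field_simps)
    then show "\<forall>\<^sub>F z in at a. norm (R z x - R a x)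
        \<le> cmod (z - a) * (C * norm (R a x) / (cmod z * (1 - cmod z)))"
      using eventually_at_in_open'[OF openU a] by (auto elim: eventually_mono)
  qed
  \<comment> \<open>Pairing with u itself makes the value at 0 the square of \<open>norm u\<close>;
    one factor cancels in the end.\<close>
  define g where "g z = cinner (R z (T u)) u" for z
  have "(g has_field_derivative cinner (R a (R a (T u))) u) (at a)" if a: "a \<in> U" for a
    unfolding has_field_derivative_iff
  proof (rule Lim_transform_eventually)
    show "((\<lambda>z. cinner (R z (R a (T u))) u) \<longlongrightarrow> cinner (R a (R a (T u))) u) (at a)"
      by (intro tendsto_cinner_left Rcont a)
    \<comment> \<open>By the resolvent identity the difference quotient is exactly this expression,
      so differentiability reduces to continuity of the resolvent.\<close>
    have "cinner (R z (R a (T u))) u = (g z - g a) / (z - a)" if "z \<in> U" "z \<noteq> a" for z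
      using that by (simp add: g_def cinner_diff_left[symmetric] resolvent[OF _ a] cinner_scaleC_left)
    then show "\<forall>\<^sub>F z in at a. cinner (R z (R a (T u))) u = (g z - g a) / (z - a)"
      using eventually_at_in_open[OF openU a] by (auto elim!: eventually_mono)
  qed
  then have gholo: "g holomorphic_on U"
    using holomorphic_on_open[OF openU] by blast
  define G where "G z = (if z = 0 then cinner u u else g z)" for z
  have Gholo: "G holomorphic_on U"
    using gholo by (rule holomorphic_transform) (auto simp: G_def U_def)
  have lim0: "(G \<longlongrightarrow> cinner u u) (at 0)"
  proof -
    \<comment> \<open>This is R z (T u) expanded with u = T p. One expansion step would leave z R z
      u, which is merely bounded; the second makes the remainder tend to 0.\<close>
    have "((\<lambda>z. u + z *\<^sub>C p + z *\<^sub>C z *\<^sub>C R z p) \<longlongrightarrow> u) (at 0)"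
    proof (rule LIM_zero_cancel, rule Lim_null_comparison)
      have "((\<lambda>z::complex. cmod z * (norm p + C * norm p / (1 - cmod z)))
          \<longlongrightarrow> cmod 0 * (norm p + C * norm p / (1 - cmod 0))) (at 0)"
        by (intro tendsto_intros) auto
      then show "((\<lambda>z::complex. cmod z * (norm p + C * norm p / (1 - cmod z))) \<longlongrightarrow> 0) (at 0)"
        by simp
      have "norm (u + z *\<^sub>C p + z *\<^sub>C z *\<^sub>C R z p - u) \<le> cmod z * (norm p + C * norm p / (1 - cmod z))"
        if z: "z \<in> U" for z
      proof -
        have "u + z *\<^sub>C p + z *\<^sub>C z *\<^sub>C R z p - u = z *\<^sub>C (p + z *\<^sub>C R z p)"
          by (simp add: scaleC_add_right)
        moreover have "norm (p + z *\<^sub>C R z p) \<le> norm p + cmod z * norm (R z p)"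
          using norm_triangle_ineq[of p "z *\<^sub>C R z p"] by (simp add: norm_scaleC)
        moreover have "cmod z * norm (R z p) \<le> C * norm p / (1 - cmod z)"
          using Rbd[OF z, of p] U(2)[OF z] by (simp add: field_simps)
        ultimately show ?thesis
          by (simp add: norm_scaleC mult_left_mono)
      qed
      then show "\<forall>\<^sub>F z in at 0. norm (u + z *\<^sub>C p + z *\<^sub>C z *\<^sub>C R z p - u)
          \<le> cmod z * (norm p + C * norm p / (1 - cmod z))"
        using eventually_at_in_open[of "ball (0::complex) 1" 0]
        by (auto elim!: eventually_mono simp: U_def)
    qed
    then have "((\<lambda>z. cinner (u + z *\<^sub>C p + z *\<^sub>C z *\<^sub>C R z p) u) \<longlongrightarrow> cinner u u) (at 0)"
      by (rule tendsto_cinner_left)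
    moreover have "cinner (u + z *\<^sub>C p + z *\<^sub>C z *\<^sub>C R z p) u = G z" if z: "z \<in> U" for z
    proof -
      have RT: "R z (T x) = x + z *\<^sub>C R z x" for x
      proof -
        have "T (x + z *\<^sub>C R z x) - z *\<^sub>C (x + z *\<^sub>C R z x)
            = T x - z *\<^sub>C x + z *\<^sub>C (T (R z x) - z *\<^sub>C R z x)"
          by (simp add: T.add TC scaleC_add_right scaleC_diff_right)
        also have "\<dots> = T x"
          unfolding R[OF z] by simp
        finally show ?thesis
          using Runiq[OF z, of "x + z *\<^sub>C R z x"] by simp
      qed
      have "R z (T u) = u + z *\<^sub>C (p + z *\<^sub>C R z p)"
        unfolding RT[of u] using RT[of p] p by simp
      then show ?thesis
        using U(1)[OF z] by (simp add: G_def g_def scaleC_add_right add.assoc)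
    qed
    then have "\<forall>\<^sub>F z in at 0. cinner (u + z *\<^sub>C p + z *\<^sub>C z *\<^sub>C R z p) u = G z"
      using eventually_at_in_open[of "ball (0::complex) 1" 0]
      by (auto elim!: eventually_mono simp: U_def)
    ultimately show ?thesis
      by (rule Lim_transform_eventually)
  qed
  have "continuous_on (ball 0 1) G"
  proof (rule continuous_at_imp_continuous_on, rule ballI)
    fix z :: complex
    assume z: "z \<in> ball 0 1"
    show "isCont G z"
    proof (cases "z = 0")
      case True
      then show ?thesis
        using lim0 by (simp add: isCont_def G_def)
    next
      case False
      with z have "z \<in> U"
        by (simp add: U_def)
      then show ?thesis
        using holomorphic_on_imp_continuous_on[OF Gholo] openU continuous_on_eq_continuous_at by blast
    qed
  qed
  then have G: "G holomorphic_on ball 0 1"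
    using Gholo unfolding U_def by (rule no_isolated_singularity) auto
  \<comment> \<open>|z| (1 - |z|) is largest at |z| = 1/2, where its value 1/4 yields the factor
    4.\<close>
  have "cmod (G 0) \<le> 4 * C * norm (T u) * norm u"
  proof (rule maximum_modulus_frontier[of G "cball 0 (1/2)"])
    show "G holomorphic_on interior (cball 0 (1/2))"
      using G by (rule holomorphic_on_subset) auto
    show "continuous_on (closure (cball 0 (1/2))) G"
      using holomorphic_on_imp_continuous_on[OF G] by (rule continuous_on_subset) auto
    show "bounded (cball (0::complex) (1/2))"
      by simp
    show "cmod (G z) \<le> 4 * C * norm (T u) * norm u" if "z \<in> frontier (cball 0 (1/2))" for z
    proof -
      have z: "cmod z = 1/2" "z \<in> U"
        using that by (auto simp: U_def)
      then have "norm (R z (T u)) \<le> 4 * C * norm (T u)"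
        using Rbd[OF z(2), of "T u"] unfolding z(1) by simp
      then have "norm (R z (T u)) * norm u \<le> 4 * C * norm (T u) * norm u"
        by (rule mult_right_mono) simp
      then show ?thesis
        using cinner_bound[of "R z (T u)" u] U(1)[OF z(2)] by (simp add: G_def g_def)
    qed
  qed simp
  then have "norm u * norm u \<le> (4 * C * norm (T u)) * norm u"
    by (simp add: G_def cinner_self norm_power power2_eq_square norm_mult)
  then show ?thesis
    using False by simp
qed (use C in simp)

text \<open>\<open>S x\<close> is the unique s in the closed range M of T with T (T s) = T x. The
  last identity says that the idempotent T S is selfadjoint, so it is the orthogonal projection onto
  M; this is where hyponormality enters.\<close>

lemma hyponormal_group_inverse:
  fixes T :: "'a::complex_hilbert_space \<Rightarrow> 'a"
  assumes T: "bounded_clinear T" and hyp: "hyponormal T" and C: "0 < C"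
    and below: "\<And>z x. cmod z < 1 \<Longrightarrow> cmod z * (1 - cmod z) * norm x \<le> C * norm (T x - z *\<^sub>C x)"
    and spec: "\<And>z. z \<noteq> 0 \<Longrightarrow> cmod z < 1 \<Longrightarrow> z \<notin> spectrum T"
  obtains S where "bounded_clinear S" "\<And>x. T (S x) = S (T x)" "\<And>x. T (S (T x)) = T x"
    "\<And>x. S (T (S x)) = S x" "\<And>x y. cinner (T (S x)) y = cinner x (T (S y))"
proof -
  interpret T: bounded_linear T
    using T by (simp add: bounded_clinear_def)
  have TC: "T (k *\<^sub>C x) = k *\<^sub>C T x" for k x
    using T by (simp add: bounded_clinear_def)
  define M where "M = closure (range T)"
  have rangeM: "T x \<in> M" for x
    unfolding M_def by (rule subsetD[OF closure_subset]) simp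
  have memM: "x \<in> M \<longleftrightarrow> (\<exists>v. (\<lambda>n. T (v n)) \<longlonglongrightarrow> x)" for x
  proof
    assume "x \<in> M"
    then obtain w where w: "\<And>n. w n \<in> range T" "w \<longlonglongrightarrow> x"
      unfolding M_def closure_sequential by blast
    then have "\<exists>v. w n = T v" for n
      by blast
    then obtain v where "\<And>n. w n = T (v n)"
      by metis
    then have "w = (\<lambda>n. T (v n))"
      by (rule ext)
    with w(2) show "\<exists>v. (\<lambda>n. T (v n)) \<longlonglongrightarrow> x"
      by blast
  next
    assume "\<exists>v. (\<lambda>n. T (v n)) \<longlonglongrightarrow> x"
    then obtain v where "(\<lambda>n. T (v n)) \<longlonglongrightarrow> x"
      by (rule exE)
    then show "x \<in> M"
      unfolding M_def closure_sequential by (intro exI[of _ "\<lambda>n. T (v n)"]) simp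
  qed
  have scaleM: "k *\<^sub>C x \<in> M" if x: "x \<in> M" for k x
  proof -
    obtain v where "(\<lambda>n. T (v n)) \<longlonglongrightarrow> x"
      using x unfolding memM by (rule exE)
    then have "(\<lambda>n. k *\<^sub>C T (v n)) \<longlonglongrightarrow> k *\<^sub>C x"
      by (rule bounded_linear.tendsto[OF bounded_linear_scaleC])
    then show ?thesis
      unfolding memM by (intro exI[of _ "\<lambda>n. k *\<^sub>C v n"]) (simp only: TC)
  qed
  have addM: "x + y \<in> M" if xy: "x \<in> M" "y \<in> M" for x y
  proof -
    obtain v w where "(\<lambda>n. T (v n)) \<longlonglongrightarrow> x" "(\<lambda>n. T (w n)) \<longlonglongrightarrow> y"
      using xy unfolding memM by (elim exE)
    then have "(\<lambda>n. T (v n + w n)) \<longlonglongrightarrow> x + y"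
      unfolding T.add by (rule tendsto_add)
    then show ?thesis
      unfolding memM by (rule exI[of _ "\<lambda>n. v n + w n"])
  qed
  have diffM: "x - y \<in> M" if "x \<in> M" "y \<in> M" for x y
    using addM[OF that(1) scaleM[OF that(2), of "- 1"]] by (simp add: scaleC_minus_left scaleC_one)
  have belowM: "norm u \<le> 4 * C * norm (T u)" if "u \<in> M" for u
  proof -
    have "closed {u. norm u \<le> 4 * C * norm (T u)}"
      by (intro closed_Collect_le continuous_intros T.continuous_on)
    moreover have "range T \<subseteq> {u. norm u \<le> 4 * C * norm (T u)}"
      using range_bounded_below[OF T C below spec] by blast
    ultimately have "M \<subseteq> {u. norm u \<le> 4 * C * norm (T u)}"
      unfolding M_def by (simp add: closure_minimal)
    with that show ?thesis
      by blast
  qed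
  have injM: "x = y" if "x \<in> M" "y \<in> M" "T x = T y" for x y
    using belowM[OF diffM[OF that(1,2)]] that(3) by (simp add: T.diff)
  \<comment> \<open>T is bounded below on the complete set M, so convergence of the images forces
    convergence of the arguments.\<close>
  have limM: "\<exists>l\<in>M. m \<longlonglongrightarrow> l \<and> T l = w" if m: "\<And>n. m n \<in> M" and w: "(\<lambda>n. T (m n)) \<longlonglongrightarrow> w" for m w
  proof -
    have "Cauchy m"
    proof (rule metric_CauchyI)
      fix e :: real
      assume e: "0 < e"
      have "Cauchy (\<lambda>n. T (m n))"
        using w by (rule LIMSEQ_imp_Cauchy)
      then obtain N where N: "\<And>i j. N \<le> i \<Longrightarrow> N \<le> j \<Longrightarrow> dist (T (m i)) (T (m j)) < e / (4 * C)"
        using metric_CauchyD[of _ "e / (4 * C)"] e C by (metis divide_pos_pos mult_pos_pos zero_less_numeral)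
      have "dist (m i) (m j) < e" if "N \<le> i" "N \<le> j" for i j
      proof -
        have "dist (m i) (m j) \<le> 4 * C * dist (T (m i)) (T (m j))"
          using belowM[OF diffM[OF m m], of i j] by (simp add: dist_norm T.diff)
        also have "\<dots> < e"
          using N[OF that] C by (simp add: field_simps)
        finally show ?thesis .
      qed
      then show "\<exists>N. \<forall>i\<ge>N. \<forall>j\<ge>N. dist (m i) (m j) < e"
        by blast
    qed
    then obtain l where l: "m \<longlonglongrightarrow> l"
      using Cauchy_convergent convergent_def by blast
    have "l \<in> M"
      using closed_sequentially[of M m l] m l by (simp add: M_def)
    moreover have "T l = w"
      using T.tendsto[OF l] w by (rule LIMSEQ_unique)
    ultimately show ?thesis
      using l by blast
  qed
  \<comment> \<open>Solve (T - z_n) v_n = x for z_n tending to 0. The resolvent bound keeps y_n =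
    z_n v_n bounded, so T y_n = z_n (x + y_n) tends to 0 and T (T v_n) tends to T x; now
    \<open>limM\<close> applies to T v_n. Taking z_n \<le> 1/2 bounds 1 - z_n away from 0.\<close>
  have approx: "\<exists>v m. m \<in> M \<and> (\<lambda>n. T (v n)) \<longlonglongrightarrow> m \<and> T m = T x" for x
  proof -
    define z where "z n = inverse (real (Suc (Suc n)))" for n
    have z: "0 < z n" "z n \<le> 1/2" for n
      by (simp_all add: z_def field_simps)
    have cz: "cmod (complex_of_real (z n)) = z n" for n
      using z[of n] by simp
    have zlim: "z \<longlonglongrightarrow> 0"
      unfolding z_def by (rule LIMSEQ_Suc[OF LIMSEQ_inverse_real_of_nat])
    have "\<exists>v. T v - complex_of_real (z n) *\<^sub>C v = x" for n
    proof -
      have "complex_of_real (z n) \<notin> spectrum T"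
        using z[of n] by (intro spec) auto
      from surjD[OF not_in_spectrumD[OF this], of x] show ?thesis
        by (auto intro: sym)
    qed
    then obtain v where v: "\<And>n. T (v n) - complex_of_real (z n) *\<^sub>C v n = x"
      by metis
    define y where "y n = complex_of_real (z n) *\<^sub>C v n" for n
    have y: "T (v n) = x + y n" for n
      using v[of n] by (simp add: y_def algebra_simps)
    have ybd: "norm (y n) \<le> 2 * C * norm x" for n
    proof -
      have "z n * (1 - z n) * norm (v n) \<le> C * norm x"
        using below[of "complex_of_real (z n)" "v n"] z[of n] by (simp add: v cz)
      moreover have "z n * norm (v n) * (1 / 2) \<le> z n * norm (v n) * (1 - z n)"
        using z[of n] by (intro mult_left_mono) auto
      moreover have "z n * norm (v n) * (1 - z n) = z n * (1 - z n) * norm (v n)"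
        by simp
      ultimately have "z n * norm (v n) \<le> 2 * C * norm x"
        by linarith
      then show ?thesis
        unfolding y_def norm_scaleC cz .
    qed
    have "(\<lambda>n. T (y n)) \<longlonglongrightarrow> 0"
    proof (rule Lim_null_comparison)
      have "(\<lambda>n. z n * (norm x + 2 * C * norm x)) \<longlonglongrightarrow> 0 * (norm x + 2 * C * norm x)"
        by (intro tendsto_intros zlim)
      then show "(\<lambda>n. z n * (norm x + 2 * C * norm x)) \<longlonglongrightarrow> 0"
        by simp
      have "norm (T (y n)) \<le> z n * (norm x + 2 * C * norm x)" for n
      proof -
        have "T (y n) = complex_of_real (z n) *\<^sub>C (x + y n)"
          using y[of n] by (simp add: y_def TC)
        moreover have "norm (x + y n) \<le> norm x + 2 * C * norm x"
          using norm_triangle_ineq[of x "y n"] ybd[of n] by linarith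
        ultimately show ?thesis
          using z(1)[of n] by (simp only: norm_scaleC cz) (simp add: mult_left_mono)
      qed
      then show "\<forall>\<^sub>F n in sequentially. norm (T (y n)) \<le> z n * (norm x + 2 * C * norm x)"
        by simp
    qed
    then have "(\<lambda>n. T x + T (y n)) \<longlonglongrightarrow> T x + 0"
      by (intro tendsto_intros)
    then have lim: "(\<lambda>n. T (T (v n))) \<longlonglongrightarrow> T x"
      by (simp add: y T.add)
    obtain m where "m \<in> M" "(\<lambda>n. T (v n)) \<longlonglongrightarrow> m" "T m = T x"
      using limM[of "\<lambda>n. T (v n)" "T x", OF rangeM lim] by (elim bexE conjE)
    then show ?thesis
      by (intro exI[of _ v] exI[of _ m]) simp
  qed
  \<comment> \<open>\<open>approx\<close> gives m in M with T m = T x, but only as a limit of T v_n.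
    Replacing each v_n by a point of M with the same image lets \<open>limM\<close> turn m into a
    value T s with s in M.\<close>
  have ex: "\<exists>s. s \<in> M \<and> T (T s) = T x" for x
  proof -
    obtain v m where v: "m \<in> M" "(\<lambda>n. T (v n)) \<longlonglongrightarrow> m" "T m = T x"
      using approx[of x] by (elim exE conjE)
    have "\<exists>k\<in>M. T k = T y" for y
      using approx[of y] by (elim exE conjE) (rule bexI)
    then obtain k where k: "\<And>y. k y \<in> M" "\<And>y. T (k y) = T y"
      by metis
    have "(\<lambda>n. T (k (v n))) \<longlonglongrightarrow> m"
      using v(2) by (simp add: k(2))
    then obtain s where "s \<in> M" "T s = m"
      using limM[of "\<lambda>n. k (v n)" m, OF k(1)] by blast
    with v(3) show ?thesis
      by blast
  qed
  then obtain S where SM: "\<And>x. S x \<in> M" and TTS: "\<And>x. T (T (S x)) = T x"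
    by metis
  have Suniq: "S x = s" if "s \<in> M" "T (T s) = T x" for x s
  proof (rule injM[OF SM that(1)], rule injM[OF rangeM rangeM])
    show "T (T (S x)) = T (T s)"
      using that(2) TTS by simp
  qed
  have comm: "T (S x) = S (T x)" for x
    by (rule Suniq[symmetric]) (simp_all add: rangeM TTS)
  have hypn: "norm (cadjoint T x) \<le> norm (T x)" for x
    using hyp hyponormal_iff[OF T] by blast
  \<comment> \<open>x - T (S x) lies in the kernel of T, hence by hyponormality in that of the
    adjoint, which is orthogonal to the range of T.\<close>
  have orth: "cinner (x - T (S x)) (T y) = 0" for x y
  proof -
    have "cadjoint T (x - T (S x)) = 0"
      using hypn[of "x - T (S x)"] by (simp add: T.diff TTS)
    then show ?thesis
      by (simp add: cinner_cadjoint_left[OF T, symmetric])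
  qed
  have PP: "cinner (T (S x)) (T (S y)) = cinner x (T (S y))" for x y
    using orth[of x "S y"] by (simp add: cinner_diff_left)
  show thesis
  proof (rule that)
    show "bounded_clinear S"
    proof (rule bounded_clinearI[where K = "4 * C * (4 * C * onorm T)"])
      show "S (x + y) = S x + S y" for x y
        by (intro Suniq addM SM) (simp add: T.add TTS)
      show "S (k *\<^sub>C x) = k *\<^sub>C S x" for k x
        by (intro Suniq scaleM SM) (simp add: TC TTS)
      show "norm (S x) \<le> 4 * C * (4 * C * onorm T) * norm x" for x
      proof -
        have "norm (S x) \<le> 4 * C * norm (T (S x))"
          by (rule belowM[OF SM])
        also have "\<dots> \<le> 4 * C * (4 * C * norm (T x))"
          using belowM[OF rangeM, of "S x"] C by (intro mult_left_mono) (simp_all add: TTS)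
        also have "\<dots> \<le> 4 * C * (4 * C * (onorm T * norm x))"
          using onorm[OF T.bounded_linear_axioms, of x] C by (intro mult_left_mono) auto
        finally show ?thesis
          by (simp add: mult_ac)
      qed
    qed
    show "T (S x) = S (T x)" for x
      by (rule comm)
    show "T (S (T x)) = T x" for x
      by (simp add: comm[symmetric] TTS)
    show "S (T (S x)) = S x" for x
      by (rule Suniq) (simp_all add: SM TTS)
    show "cinner (T (S x)) y = cinner x (T (S y))" for x y
    proof -
      have "cinner (T (S x)) y = cnj (cinner y (T (S x)))"
        by (rule cinner_commute)
      also have "\<dots> = cnj (cinner (T (S y)) (T (S x)))"
        by (simp only: PP)
      also have "\<dots> = cinner (T (S x)) (T (S y))"
        by (rule cinner_commute[symmetric])
      finally show ?thesis
        by (simp only: PP)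
    qed
  qed
qed

text \<open>Inverse letters are appended in reverse order, and P in the middle is carried outward as
  pairs cancel, so P need not commute with the letters.\<close>

lemma word_group_inverse:
  assumes "\<And>A. A \<in> set As \<Longrightarrow> inv_of A \<in> \<B> \<and> (\<forall>x. A (P (inv_of A x)) = P x)"
  shows "\<exists>Bs. set Bs \<subseteq> \<B> \<and> length Bs = length As \<and> (\<forall>x. word As (P (word Bs x)) = P x)"
  using assms
proof (induction As)
  case Nil
  show ?case
    by (intro exI[of _ "[]"]) simp
next
  case (Cons A As)
  then obtain Bs where Bs: "set Bs \<subseteq> \<B>" "length Bs = length As"
    "\<And>x. word As (P (word Bs x)) = P x"
    by auto
  have "inv_of A \<in> \<B>" "\<And>x. A (P (inv_of A x)) = P x"
    using Cons.prems[of A] by auto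
  then show ?case
    using Bs by (intro exI[of _ "Bs @ [inv_of A]"]) simp
qed

section \<open>Normality by passing to the group inverse\<close>

theorem theorem4p4:
  fixes T :: "'a::complex_hilbert_space \<Rightarrow> 'a"
  assumes "bounded_clinear T"
    and "hyponormal T"
    and "\<exists>z. cmod z = 1 \<and> z \<notin> frontier (spectrum T)"
    and "SI_semigroup (star_semigroup T)"
  shows "normal_operator T"
proof (cases "cadjoint T = T")
  case True
  then show ?thesis
    by (simp add: normal_operator_def)
next
  case False
  note T = assms(1) and hyp = assms(2)
  let ?Y = "cadjoint T"
  obtain z0 where z0: "cmod z0 = 1" "z0 \<notin> frontier (spectrum T)"
    using assms(3) by blast
  obtain As where As: "set As \<subseteq> {T, ?Y}" "2 \<le> length As" "?Y = word As"
    using SI_adjoint_word[OF assms(4) False] .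
  have le: "norm (T x) \<le> norm x" for x
    by (rule contraction_of_adjoint_word[OF T hyp As])
  define C where "C = real (length As) + 1"
  have C: "0 < C"
    by (simp add: C_def)
  have below: "cmod z * (1 - cmod z) * norm x \<le> C * norm (T x - z *\<^sub>C x)" if "cmod z < 1" for z x
    using bounded_below_of_adjoint_word[OF T hyp le As, of z x] that
    unfolding C_def by simp
  have spec: "z \<notin> spectrum T" if "z \<noteq> 0" "cmod z < 1" for z
  proof (rule punctured_disc_not_in_spectrum[OF T le _ z0 that])
    fix w :: complex
    assume w: "w \<noteq> 0" "cmod w < 1"
    then have "0 < cmod w * (1 - cmod w) / C"
      using C by simp
    moreover have "cmod w * (1 - cmod w) / C * norm x \<le> norm (T x - w *\<^sub>C x)" for x
      using below[OF w(2), of x] C by (simp add: field_simps)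
    ultimately show "\<exists>c>0. \<forall>x. c * norm x \<le> norm (T x - w *\<^sub>C x)"
      by blast
  qed
  obtain S where S: "bounded_clinear S" and TS: "\<And>x. T (S x) = S (T x)"
    and TST: "\<And>x. T (S (T x)) = T x" and STS: "\<And>x. S (T (S x)) = S x"
    and TS_self: "\<And>x y. cinner (T (S x)) y = cinner x (T (S y))"
    by (rule hyponormal_group_inverse[OF T hyp C below spec]; (rule that)?; assumption)
  let ?Z = "cadjoint S"
  define P where "P x = T (S x)" for x
  have self: "cinner (P x) y = cinner x (P y)" for x y
    unfolding P_def by (rule TS_self)
  have PT: "P (T x) = T x" and TP: "T (P x) = T x" and ST: "S (T x) = P x" for x
    by (simp_all add: P_def TS TST[unfolded TS])
  have PS: "P (S x) = S x" for x
    by (simp add: P_def TS STS[unfolded TS])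
  have PP: "P (P x) = P x" for x
    by (simp add: P_def TST)
  have ZY: "?Z (?Y x) = P x" for x
  proof (rule cinner_eqI)
    show "cinner y (?Z (?Y x)) = cinner y (P x)" for y
      unfolding cinner_cadjoint[OF S, symmetric] cinner_cadjoint[OF T, symmetric]
      by (simp only: P_def[symmetric] self)
  qed
  have YZ: "?Y (?Z x) = P x" for x
  proof (rule cinner_eqI)
    show "cinner y (?Y (?Z x)) = cinner y (P x)" for y
      unfolding cinner_cadjoint[OF S, symmetric] cinner_cadjoint[OF T, symmetric]
      by (simp only: ST self)
  qed
  have YP: "?Y (P x) = ?Y x" for x
  proof (rule cinner_eqI)
    show "cinner y (?Y (P x)) = cinner y (?Y x)" for y
      using self[of "T y" x] unfolding cinner_cadjoint[OF T, symmetric] PT by (rule sym)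
  qed
  have ZP: "?Z (P x) = ?Z x" for x
  proof (rule cinner_eqI)
    show "cinner y (?Z (P x)) = cinner y (?Z x)" for y
      using self[of "S y" x] unfolding cinner_cadjoint[OF S, symmetric] PS by (rule sym)
  qed
  have PZ: "P (?Z x) = ?Z x" for x
    using ZY[of "?Z x"] by (simp add: YZ ZP)
  have Ple: "norm (P x) \<le> norm x" for x
  proof (cases "P x = 0")
    case False
    have "complex_of_real ((norm (P x))\<^sup>2) = cinner x (P x)"
      unfolding cinner_self[symmetric] using self[of x "P x"] by (simp only: PP)
    then have "(norm (P x))\<^sup>2 = cmod (cinner x (P x))"
      by (metis abs_power2 norm_of_real)
    then have "norm (P x) * norm (P x) \<le> norm x * norm (P x)"
      using cinner_bound[of x "P x"] by (simp add: power2_eq_square)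
    with False show ?thesis
      by simp
  qed simp
  have hypS: "hyponormal S"
    unfolding hyponormal_iff[OF S]
  proof
    fix x
    have hypn: "norm (?Y y) \<le> norm (T y)" for y
      using hyp hyponormal_iff[OF T] by blast
    \<comment> \<open>Moving T and S across gives the square of \<open>norm (?Z x)\<close> as the
      inner product of S x with \<open>?Y (S (?Z x))\<close>. Hyponormality of T bounds the norm of
      the latter by that of \<open>P (?Z x)\<close>, hence by \<open>norm (?Z x)\<close>.\<close>
    have "?Z x = ?Z (T (S x))"
      using ZP[of x] by (simp add: P_def)
    then have "cinner (?Z x) (?Z x) = cinner (S x) (?Y (S (?Z x)))"
      by (simp add: cinner_cadjoint_left[OF S] cinner_cadjoint[OF T])
    then have "norm (?Z x) * norm (?Z x) \<le> norm (S x) * norm (?Y (S (?Z x)))"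
      using cinner_bound[of "S x" "?Y (S (?Z x))"]
      by (metis cinner_self norm_of_real abs_power2 power2_eq_square)
    also have "norm (?Y (S (?Z x))) \<le> norm (?Z x)"
      using hypn[of "S (?Z x)"] Ple[of "?Z x"] by (simp add: P_def)
    then have "norm (S x) * norm (?Y (S (?Z x))) \<le> norm (S x) * norm (?Z x)"
      by (rule mult_left_mono) simp
    finally show "norm (?Z x) \<le> norm (S x)"
      by (cases "?Z x = 0") auto
  qed
  obtain Bs where Bs: "set Bs \<subseteq> {S, ?Z}" "length Bs = length As"
    "\<And>x. word As (P (word Bs x)) = P x"
  proof -
    have "\<exists>Bs. set Bs \<subseteq> {S, ?Z} \<and> length Bs = length As \<and> (\<forall>x. word As (P (word Bs x)) = P x)"
    proof (rule word_group_inverse[where inv_of = "\<lambda>A. if A = T then S else ?Z"])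
      fix A
      assume "A \<in> set As"
      then have "A = T \<or> A = ?Y"
        using As(1) by blast
      then show "(if A = T then S else ?Z) \<in> {S, ?Z}
          \<and> (\<forall>x. A (P ((if A = T then S else ?Z) x)) = P x)"
        by (auto simp: PS PZ YZ P_def[symmetric])
    qed
    with that show thesis
      by blast
  qed
  \<comment> \<open>On the range of P the equation \<open>?Y = word As\<close> is inverted:
    \<open>?Z\<close> undoes \<open>?Y\<close>, and \<open>Bs\<close> undoes \<open>As\<close>. The
    remaining P is absorbed by the first letter of \<open>Bs\<close>, which exists because
    \<open>As\<close> is nonempty.\<close>
  have "?Z x = word Bs x" for x
  proof -
    have "?Z x = ?Z (P x)"
      by (simp add: ZP)
    also have "\<dots> = ?Z (?Y (P (word Bs x)))"
      unfolding As(3) Bs(3) ..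
    also have "\<dots> = P (word Bs x)"
      by (simp add: ZY PP)
    also have "\<dots> = word Bs x"
    proof -
      obtain B Bs' where B: "Bs = B # Bs'"
        using Bs(2) As(2) by (cases Bs) auto
      then have "B = S \<or> B = ?Z"
        using Bs(1) by auto
      with B show ?thesis
        by (auto simp: PS PZ)
    qed
    finally show ?thesis .
  qed
  then have "?Z = word Bs"
    by (rule ext)
  then have leS: "norm (S x) \<le> norm x" for x
    using Bs As(2) by (intro contraction_of_adjoint_word[OF S hypS, of Bs]) auto
  \<comment> \<open>T = T P and P = S T, with T and S both contractions.\<close>
  have isometric: "norm (T x) = norm (P x)" for x
  proof (rule antisym)
    show "norm (T x) \<le> norm (P x)"
      using le[of "P x"] by (simp only: TP)
    show "norm (P x) \<le> norm (T x)"
      using leS[of "T x"] by (simp only: ST)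
  qed
  \<comment> \<open>Equality case: the adjoint is a contraction and the inner product of
    \<open>?Y (T x)\<close> with P x is already the square of \<open>norm (T x)\<close>, so the
    squared distance between them is at most 0. It follows that the adjoint of T is S, which
    commutes with T.\<close>
  have YT: "?Y (T x) = P x" for x
  proof -
    have "cinner (?Y (T x)) (P x) = complex_of_real ((norm (T x))\<^sup>2)"
      by (simp only: cinner_cadjoint_left[OF T] TP cinner_self)
    moreover have "norm (?Y (T x)) \<le> 1 * norm (T x)"
      using le by (intro norm_cadjoint_le[OF T]) simp
    then have "(norm (?Y (T x)))\<^sup>2 \<le> (norm (T x))\<^sup>2"
      by (intro power_mono) simp_all
    ultimately have "(norm (?Y (T x) - P x))\<^sup>2 \<le> 0"
      by (simp add: norm_diff_square isometric)
    then show ?thesis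
      by simp
  qed
  have "?Y x = S x" for x
  proof -
    have "?Y x = ?Y (T (S x))"
      using YP[of x] by (simp add: P_def)
    then show ?thesis
      by (simp add: YT PS)
  qed
  then have "T (?Y x) = ?Y (T x)" for x
    by (simp add: TS)
  then show ?thesis
    by (simp add: normal_operator_def fun_eq_iff)
qed

end
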